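(* Assume the standing hypotheses below. Let $t_{\min}$ be a greatest common divisor of $f_{\min}$ and $g_{\min}$ in $R$, and $t_{\max}$ a greatest common divisor of $f_{\max}$ and $g_{\max}$ in $R$. Then $t_{\min}\in\mathfrak p$ and $t_{\max}\in\mathfrak p$.
   Context: Let $k$ be an algebraically closed field of characteristic zero, $R=k[w,x,y,z]$, and let $\mathfrak p\subseteq R$ be the homogeneous prime ideal of Macaulay's curve $C_4\subseteq\mathbb P^3_k$, the curve with parametrization $[s^4:s^3t:st^3:t^4]$. Endow $R$ with the bigrading $\deg w=(4,0)$, $\deg x=(3,1)$, $\deg y=(1,3)$, $\deg z=(0,4)$; $\mathfrak p$ is bihomogeneous. Standing hypothesis: $f,g\in\mathfrak p$ are homogeneous (in the usual grading) of degrees $d_1,d_2$ with $\sqrt{(f,g)R}=\mathfrak p$. Write $f=\sum_{i=i_{\min}}^{i_{\max}} f^{(i,4d_1-i)}$ and $g=\sum_{j=j_{\min}}^{j_{\max}} g^{(j,4d_2-j)}$ as sums of bihomogeneous components, where $f^{(i,4d_1-i)}$ is the component of bidegree $(i,4d_1-i)$ and $i_{\min},i_{\max},j_{\min},j_{\max}$ are chosen so that $f_{\min}:=f^{(i_{\min},4d_1-i_{\min})}$, $f_{\max}:=f^{(i_{\max},4d_1-i_{\max})}$, $g_{\min}:=g^{(j_{\min},4d_2-j_{\min})}$, $g_{\max}:=g^{(j_{\max},4d_2-j_{\max})}$ are all nonzero. *)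

theory Defs
  imports "HOL-Library.Poly_Mapping" "HOL-Computational_Algebra.Polynomial"
begin

datatype var = W | X | Y | Z

type_synonym 'k mpoly4 = "(var \<Rightarrow>\<^sub>0 nat) \<Rightarrow>\<^sub>0 'k"

definition alg_closed_field :: "'k::field itself \<Rightarrow> bool" where
  "alg_closed_field _ \<longleftrightarrow> (\<forall>q::'k poly. degree q > 0 \<longrightarrow> (\<exists>a. poly q a = 0))"

definition tdeg :: "(var \<Rightarrow>\<^sub>0 nat) \<Rightarrow> nat" where
  "tdeg m = Poly_Mapping.lookup m W + Poly_Mapping.lookup m X + Poly_Mapping.lookup m Y + Poly_Mapping.lookup m Z"

definition homogeneous :: "'k::zero mpoly4 \<Rightarrow> nat \<Rightarrow> bool" where
  "homogeneous F d \<longleftrightarrow> (\<forall>m\<in>Poly_Mapping.keys F. tdeg m = d)"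

definition bideg :: "(var \<Rightarrow>\<^sub>0 nat) \<Rightarrow> nat \<times> nat" where
  "bideg m = (4 * Poly_Mapping.lookup m W + 3 * Poly_Mapping.lookup m X + Poly_Mapping.lookup m Y,
              Poly_Mapping.lookup m X + 3 * Poly_Mapping.lookup m Y + 4 * Poly_Mapping.lookup m Z)"

text \<open>Bihomogeneous component of F of bidegree (i, 4d - i) (for F homogeneous of degree d).\<close>
definition bicomp :: "'k::zero mpoly4 \<Rightarrow> nat \<Rightarrow> 'k mpoly4" where
  "bicomp F i = Poly_Mapping.mapp (\<lambda>m c. if fst (bideg m) = i then c else 0) F"

definition imin :: "'k::zero mpoly4 \<Rightarrow> nat" where
  "imin F = Min ((\<lambda>m. fst (bideg m)) ` Poly_Mapping.keys F)"

definition imax :: "'k::zero mpoly4 \<Rightarrow> nat" where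
  "imax F = Max ((\<lambda>m. fst (bideg m)) ` Poly_Mapping.keys F)"

definition comp_min :: "'k::zero mpoly4 \<Rightarrow> 'k mpoly4" where
  "comp_min F = bicomp F (imin F)"

definition comp_max :: "'k::zero mpoly4 \<Rightarrow> 'k mpoly4" where
  "comp_max F = bicomp F (imax F)"

definition eval4 :: "'k::comm_semiring_1 mpoly4 \<Rightarrow> 'k \<Rightarrow> 'k \<Rightarrow> 'k \<Rightarrow> 'k \<Rightarrow> 'k" where
  "eval4 F a b c e = (\<Sum>m\<in>Poly_Mapping.keys F. Poly_Mapping.lookup F m * a ^ Poly_Mapping.lookup m W * b ^ Poly_Mapping.lookup m X
                                     * c ^ Poly_Mapping.lookup m Y * e ^ Poly_Mapping.lookup m Z)"

text \<open>The ideal of Macaulay's curve C_4 = {[s^4:s^3t:st^3:t^4]}: all polynomials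
 vanishing on its affine cone.\<close>
definition macaulay_ideal :: "'k::comm_semiring_1 mpoly4 set" where
  "macaulay_ideal = {F. \<forall>s t. eval4 F (s^4) (s^3 * t) (s * t^3) (t^4) = 0}"

definition ideal2 :: "'a::comm_semiring_1 \<Rightarrow> 'a \<Rightarrow> 'a set" where
  "ideal2 f g = {a * f + b * g | a b. True}"

definition radical :: "'a::comm_semiring_1 set \<Rightarrow> 'a set" where
  "radical I = {h. \<exists>n. h ^ n \<in> I}"

definition is_gcd :: "'a::comm_semiring_1 \<Rightarrow> 'a \<Rightarrow> 'a \<Rightarrow> bool" where
  "is_gcd t f g \<longleftrightarrow> t dvd f \<and> t dvd g \<and> (\<forall>e. e dvd f \<and> e dvd g \<longrightarrow> e dvd t)"

end

theory Submission
  imports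
    "Berlekamp_Zassenhaus.Unique_Factorization_Poly"
    "Subresultants.Resultant_Prelim"
    "HOL-Library.Product_Plus"
    "HOL-Number_Theory.Cong"
    Defs
begin

text \<open>
  Suppose that the gcd \<open>t\<close> of the lowest components \<open>f0 = t f'\<close> and \<open>g0 = t g'\<close> is not in the prime
  ideal \<open>p\<close> of the curve. (The highest components are the lowest ones for the second degree.)

  The degree \<open>e\<close> of \<open>t\<close> is zero: since \<open>t\<close> is a monomial modulo \<open>p\<close>, and \<open>p\<close> is nilpotent modulo
  \<open>(f, g)\<close>, powers of \<open>x\<close>, \<open>y\<close> and \<open>w z\<close> lie in \<open>(f, g, t)\<close>. Replacing \<open>t f'\<close> and \<open>t g'\<close> by \<open>f\<close> and \<open>g\<close>
  up to terms of higher bidegree shows that in degree \<open>n\<close> the quotient by \<open>(f, g)\<close> is spanned by \<open>t\<close>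
  times the quotient by \<open>(f', g')\<close> in degree \<open>n - e\<close> and a bounded number of monomials. These
  quotients grow like \<open>d1 d2 n\<close> and \<open>(d1 - e) (d2 - e) n\<close>, which forces \<open>e = 0\<close>.

  So \<open>f0\<close> and \<open>g0\<close> are coprime, and a Koszul argument gives that \<open>p\<close> is the radical of
  \<open>(f0, g0)\<close>. One of the two, say \<open>f0\<close>, then contains a power of \<open>x\<close> and the other one a power \<open>y ^ d\<close>.
  On the slice \<open>(1, 1, u, \<epsilon> u)\<close> all other monomials of \<open>g0\<close> are divisible by \<open>\<epsilon> ^ 2\<close>, so the
  resultant in \<open>u\<close> is a nonzero constant modulo \<open>\<epsilon> ^ 2\<close>. But it vanishes exactly at \<open>\<epsilon> = 1\<close>, so
  it is \<open>c (\<epsilon> - 1) ^ k\<close> with \<open>k > 0\<close>, whose linear coefficient is nonzero in characteristic zero.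
\<close>

abbreviation lookup :: "('a \<Rightarrow>\<^sub>0 'b::zero) \<Rightarrow> 'a \<Rightarrow> 'b" where "lookup \<equiv> Poly_Mapping.lookup"
abbreviation keys :: "('a \<Rightarrow>\<^sub>0 'b::zero) \<Rightarrow> 'a set" where "keys \<equiv> Poly_Mapping.keys"
abbreviation single :: "'a \<Rightarrow> 'b::zero \<Rightarrow> 'a \<Rightarrow>\<^sub>0 'b" where "single \<equiv> Poly_Mapping.single"

type_synonym expo = "var \<Rightarrow>\<^sub>0 nat"

text \<open>Any linear order on the variables makes the polynomial ring an instance of \<open>idom\<close>.\<close>

instantiation var :: linorder
begin

primrec var_index :: "var \<Rightarrow> nat" where
  "var_index W = 0" | "var_index X = 1" | "var_index Y = 2" | "var_index Z = 3"

definition "a \<le> b \<longleftrightarrow> var_index a \<le> var_index b"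
definition "a < b \<longleftrightarrow> var_index a < var_index b"

instance
proof
  fix x y :: var
  show "x \<le> y \<Longrightarrow> y \<le> x \<Longrightarrow> x = y"
    by (cases x; cases y) (auto simp: less_eq_var_def)
qed (auto simp: less_eq_var_def less_var_def)

end

subsection \<open>Evaluation homomorphisms\<close>

lemma poly_mapping_eq_sum_single: "F = (\<Sum>m\<in>keys F. single m (lookup F m))"
  for F :: "'a \<Rightarrow>\<^sub>0 'b::comm_monoid_add"
proof (rule poly_mapping_eqI)
  fix k
  have "(\<Sum>m\<in>keys F. lookup (single m (lookup F m)) k) = (\<Sum>m\<in>keys F. if m = k then lookup F m else 0)"
    by (rule sum.cong) (auto simp: lookup_single when_def)
  then show "lookup F k = lookup (\<Sum>m\<in>keys F. single m (lookup F m)) k"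
    by (simp add: lookup_sum in_keys_iff)
qed

text \<open>\<open>\<iota>\<close> acts on coefficients and \<open>\<phi>\<close> on monomials, so
  the same homomorphism facts serve for evaluation at a point and for the passage to iterated
  polynomials.\<close>

definition mapping_eval :: "('k::zero \<Rightarrow> 'r) \<Rightarrow> ('m \<Rightarrow> 'r) \<Rightarrow> ('m \<Rightarrow>\<^sub>0 'k) \<Rightarrow> 'r::comm_ring_1" where
  "mapping_eval \<iota> \<phi> F = (\<Sum>m\<in>keys F. \<iota> (lookup F m) * \<phi> m)"

locale eval_hom =
  fixes \<iota> :: "'k::comm_ring_1 \<Rightarrow> 'r::comm_ring_1" and \<phi> :: "'m::comm_monoid_add \<Rightarrow> 'r"
  assumes iota_0: "\<iota> 0 = 0" and iota_1: "\<iota> 1 = 1"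
    and iota_add: "\<iota> (a + b) = \<iota> a + \<iota> b" and iota_mult: "\<iota> (a * b) = \<iota> a * \<iota> b"
    and phi_0: "\<phi> 0 = 1" and phi_add: "\<phi> (m + n) = \<phi> m * \<phi> n"
begin

abbreviation "ev \<equiv> mapping_eval \<iota> \<phi>"

lemma ev_superset:
  assumes "finite A" "keys F \<subseteq> A"
  shows "ev F = (\<Sum>m\<in>A. \<iota> (lookup F m) * \<phi> m)"
  unfolding mapping_eval_def
  by (rule sum.mono_neutral_left) (use assms in \<open>auto simp: in_keys_iff iota_0\<close>)

lemma ev_add: "ev (F + G) = ev F + ev G"
proof -
  let ?A = "keys F \<union> keys G"
  have "ev (F + G) = (\<Sum>m\<in>?A. \<iota> (lookup (F + G) m) * \<phi> m)"
    by (rule ev_superset) (use keys_add[of F G] in auto)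
  also have "\<dots> = (\<Sum>m\<in>?A. \<iota> (lookup F m) * \<phi> m) + (\<Sum>m\<in>?A. \<iota> (lookup G m) * \<phi> m)"
    by (simp add: lookup_add iota_add algebra_simps sum.distrib)
  also have "\<dots> = ev F + ev G"
    by (simp add: ev_superset[of ?A F] ev_superset[of ?A G])
  finally show ?thesis .
qed

lemma ev_0 [simp]: "ev 0 = 0"
  by (simp add: mapping_eval_def)

lemma ev_single [simp]: "ev (single m c) = \<iota> c * \<phi> m"
  by (simp add: mapping_eval_def iota_0)

lemma ev_1 [simp]: "ev 1 = 1"
  using ev_single[of 0 1] by (simp add: iota_1 phi_0)

lemma ev_sum: "ev (\<Sum>x\<in>A. F x) = (\<Sum>x\<in>A. ev (F x))"
  by (induction A rule: infinite_finite_induct) (auto simp: ev_add)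

lemma ev_mult: "ev (F * G) = ev F * ev G"
proof -
  have "F * G = (\<Sum>m\<in>keys F. single m (lookup F m)) * (\<Sum>n\<in>keys G. single n (lookup G n))"
    using poly_mapping_eq_sum_single[of F] poly_mapping_eq_sum_single[of G] by simp
  also have "\<dots> = (\<Sum>m\<in>keys F. \<Sum>n\<in>keys G. single (m + n) (lookup F m * lookup G n))"
    by (simp add: sum_product mult_single)
  also have "ev \<dots> = (\<Sum>m\<in>keys F. \<Sum>n\<in>keys G. (\<iota> (lookup F m) * \<phi> m) * (\<iota> (lookup G n) * \<phi> n))"
    by (simp add: ev_sum iota_mult phi_add algebra_simps)
  also have "\<dots> = ev F * ev G"
    by (simp add: mapping_eval_def sum_product)
  finally show ?thesis .
qed

lemma ev_power: "ev (F ^ n) = ev F ^ n"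
  by (induction n) (auto simp: ev_mult)

lemma ev_uminus: "ev (- F) = - ev F"
  using ev_add[of F "- F"] by (simp add: eq_neg_iff_add_eq_0 add.commute)

lemma ev_diff: "ev (F - G) = ev F - ev G"
  using ev_add[of F "- G"] by (simp add: ev_uminus)

end

section \<open>Evaluation at points of affine four-space\<close>

definition mon_eval :: "'k::comm_ring_1 \<Rightarrow> 'k \<Rightarrow> 'k \<Rightarrow> 'k \<Rightarrow> expo \<Rightarrow> 'k" where
  "mon_eval a b c e m = a ^ lookup m W * b ^ lookup m X * c ^ lookup m Y * e ^ lookup m Z"

lemma eval4_eq_mapping_eval:
  "eval4 F a b c e = mapping_eval (\<lambda>x. x) (mon_eval a b c e) F" for F :: "'k::comm_ring_1 mpoly4"
  by (simp add: eval4_def mapping_eval_def mon_eval_def mult.assoc)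

interpretation eval4: eval_hom "\<lambda>x. x" "mon_eval a b c e"
  rewrites "mapping_eval (\<lambda>x. x) (mon_eval a b c e) = (\<lambda>F. eval4 F a b c e)"
  by unfold_locales
    (auto simp: mon_eval_def lookup_add power_add algebra_simps eval4_eq_mapping_eval)

lemma macaulay_idealI: "(\<And>s t. eval4 F (s^4) (s^3 * t) (s * t^3) (t^4) = 0) \<Longrightarrow> F \<in> macaulay_ideal"
  by (simp add: macaulay_ideal_def)

subsection \<open>Unique factorisation\<close>

text \<open>Induction over the prime factors of \<open>g\<close>: such a prime cannot divide
  \<open>f\<close>, since it would be a common divisor that is not a unit, so it divides
  \<open>a\<close> and can be cancelled.\<close>

lemma ufd_coprime_dvd_mult:
  fixes a f g :: "'a::ufd"
  assumes "\<And>r. r dvd f \<Longrightarrow> r dvd g \<Longrightarrow> r dvd 1" "g dvd a * f" "g \<noteq> 0"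
  shows "g dvd a"
proof (cases "g dvd 1")
  case False
  then obtain F where F: "mset_factors F g"
    using mset_factors_exist assms(3) by blast
  have main: "(\<And>r. r dvd f \<Longrightarrow> r dvd prod_mset F \<Longrightarrow> r dvd 1) \<Longrightarrow> prod_mset F dvd a * f \<Longrightarrow>
    \<forall>p\<in>#F. prime_elem p \<Longrightarrow> prod_mset F dvd a" for F and a :: 'a
  proof (induction F arbitrary: a)
    case empty
    then show ?case by simp
  next
    case (add p F)
    have p: "prime_elem p" using add.prems by simp
    have "p dvd a * f" using dvd_mult_left[of p "prod_mset F" "a * f"] add.prems(2) by simp
    moreover have "\<not> p dvd f"
      using add.prems(1)[of p] p by (auto simp: prime_elem_def)
    ultimately have "p dvd a" using prime_elem_dvd_multD[OF p, of a f] by simp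
    then obtain a' where a': "a = p * a'" by (elim dvdE)
    have "p * prod_mset F dvd p * (a' * f)"
      using add.prems(2) by (simp add: a' mult.assoc)
    then have "prod_mset F dvd a' * f"
      using p by (simp add: prime_elem_def)
    then have "prod_mset F dvd a'"
    proof (rule add.IH[rotated])
      fix r assume "r dvd f" "r dvd prod_mset F"
      then show "r dvd 1" by (intro add.prems(1)) simp_all
    qed (use add.prems(3) in simp)
    then show ?case by (simp add: a')
  qed
  show ?thesis
    using main[of F a] F assms(1,2) by (auto elim!: mset_factorsE)
qed (meson one_dvd dvd_trans)

section \<open>Comparison with the iterated univariate polynomial ring\<close>

definition mon_poly4 :: "expo \<Rightarrow> 'k::comm_ring_1 poly poly poly poly" where
  "mon_poly4 m = monom (monom (monom (monom 1 (lookup m W)) (lookup m X)) (lookup m Y)) (lookup m Z)"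

definition const_poly4 :: "'k::comm_ring_1 \<Rightarrow> 'k poly poly poly poly" where
  "const_poly4 c = [:[:[:[:c:]:]:]:]"

interpretation poly4: eval_hom const_poly4 "mon_poly4 :: expo \<Rightarrow> 'k::comm_ring_1 poly poly poly poly"
  by unfold_locales
    (auto simp: const_poly4_def mon_poly4_def lookup_add mult_monom monom_0)

text \<open>\<open>W\<close> is the innermost variable and \<open>Z\<close> the outermost. Over a
  field the target is factorial, and the isomorphism brings this back to
  \<open>mpoly4\<close>.\<close>

abbreviation to_poly4 :: "'k::comm_ring_1 mpoly4 \<Rightarrow> 'k poly poly poly poly" where
  "to_poly4 \<equiv> mapping_eval const_poly4 mon_poly4"

definition expo4 :: "nat \<Rightarrow> nat \<Rightarrow> nat \<Rightarrow> nat \<Rightarrow> expo" where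
  "expo4 a b c e = single W a + single X b + single Y c + single Z e"

lemma lookup_expo4 [simp]:
  "lookup (expo4 a b c e) W = a" "lookup (expo4 a b c e) X = b"
  "lookup (expo4 a b c e) Y = c" "lookup (expo4 a b c e) Z = e"
  by (auto simp: expo4_def lookup_add lookup_single when_def)

lemma expo_eqI:
  fixes m n :: expo
  assumes "lookup m W = lookup n W" "lookup m X = lookup n X"
    "lookup m Y = lookup n Y" "lookup m Z = lookup n Z"
  shows "m = n"
proof (rule poly_mapping_eqI)
  fix v show "lookup m v = lookup n v" by (cases v) (use assms in auto)
qed

lemma coeff_to_poly4:
  "coeff (coeff (coeff (coeff (to_poly4 F) e) c) b) a = lookup F (expo4 a b c e)"
proof -
  have "coeff (coeff (coeff (coeff (to_poly4 F) e) c) b) a =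
    (\<Sum>m\<in>keys F. if m = expo4 a b c e then lookup F m else 0)"
    unfolding mapping_eval_def coeff_sum
    by (rule sum.cong) (auto simp: const_poly4_def mon_poly4_def smult_monom intro: expo_eqI)
  then show ?thesis by (simp add: in_keys_iff)
qed

lemma inj_to_poly4: "to_poly4 F = to_poly4 G \<Longrightarrow> F = G"
proof (rule poly_mapping_eqI)
  fix m assume "to_poly4 F = to_poly4 G"
  then have "lookup F (expo4 (lookup m W) (lookup m X) (lookup m Y) (lookup m Z)) =
    lookup G (expo4 (lookup m W) (lookup m X) (lookup m Y) (lookup m Z))"
    by (simp flip: coeff_to_poly4)
  moreover have "expo4 (lookup m W) (lookup m X) (lookup m Y) (lookup m Z) = m"
    by (rule expo_eqI) auto
  ultimately show "lookup F m = lookup G m" by simp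
qed

text \<open>The range is closed under sums and products and contains constants and variables, so it
  absorbs one level of polynomial coefficients after the other.\<close>

lemma surj_to_poly4: "\<exists>F. to_poly4 F = (P :: 'k::comm_ring_1 poly poly poly poly)"
proof -
  let ?R = "range (to_poly4 :: 'k mpoly4 \<Rightarrow> _)"
  have plus: "P + Q \<in> ?R" and times: "P * Q \<in> ?R" if "P \<in> ?R" "Q \<in> ?R" for P Q
    using that by (auto simp flip: poly4.ev_add poly4.ev_mult)
  have cst: "[:[:[:[:c:]:]:]:] \<in> ?R" for c
    by (rule range_eqI[of _ _ "single 0 c"]) (simp add: const_poly4_def mon_poly4_def monom_0)
  have var: "mon_poly4 m \<in> ?R" for m
    by (rule range_eqI[of _ _ "single m 1"]) (simp add: const_poly4_def)
  have 1: "[:[:[:p:]:]:] \<in> ?R" for p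
  proof (induction p)
    case (pCons c p)
    have "[:[:[:pCons c p:]:]:] = [:[:[:[:c:]:]:]:] + mon_poly4 (expo4 1 0 0 0) * [:[:[:p:]:]:]"
      by (simp add: mon_poly4_def monom_Suc monom_0)
    then show ?case by (simp only:) (intro plus times cst var pCons)
  qed (use cst[of 0] in simp)
  have 2: "[:[:p:]:] \<in> ?R" for p
  proof (induction p)
    case (pCons c p)
    have "[:[:pCons c p:]:] = [:[:[:c:]:]:] + mon_poly4 (expo4 0 1 0 0) * [:[:p:]:]"
      by (simp add: mon_poly4_def monom_Suc monom_0)
    then show ?case by (simp only:) (intro plus times 1 var pCons)
  qed (use cst[of 0] in simp)
  have 3: "[:p:] \<in> ?R" for p
  proof (induction p)
    case (pCons c p)
    have "[:pCons c p:] = [:[:c:]:] + mon_poly4 (expo4 0 0 1 0) * [:p:]"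
      by (simp add: mon_poly4_def monom_Suc monom_0)
    then show ?case by (simp only:) (intro plus times 2 var pCons)
  qed (use cst[of 0] in simp)
  have "P \<in> ?R"
  proof (induction P)
    case (pCons c p)
    have "pCons c p = [:c:] + mon_poly4 (expo4 0 0 0 1) * p"
      by (simp add: mon_poly4_def monom_Suc monom_0)
    then show ?case by (simp only:) (intro plus times 3 var pCons)
  qed (use cst[of 0] in simp)
  then show ?thesis by auto
qed

lemma to_poly4_dvd_iff: "to_poly4 F dvd to_poly4 G \<longleftrightarrow> F dvd G"
proof
  assume "to_poly4 F dvd to_poly4 G"
  then obtain Q where "to_poly4 G = to_poly4 F * Q" by (elim dvdE)
  moreover obtain H where "to_poly4 H = Q" using surj_to_poly4 by blast
  ultimately have "to_poly4 G = to_poly4 (F * H)" by (simp add: poly4.ev_mult)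
  then show "F dvd G" using inj_to_poly4 by (metis dvd_triv_left)
qed (auto simp: poly4.ev_mult)

lemma mpoly4_coprime_dvd_mult:
  fixes a f g :: "'k::field mpoly4"
  assumes "\<And>r. r dvd f \<Longrightarrow> r dvd g \<Longrightarrow> r dvd 1" "g dvd a * f" "g \<noteq> 0"
  shows "g dvd a"
proof -
  have "to_poly4 g dvd to_poly4 a"
  proof (rule ufd_coprime_dvd_mult)
    fix r assume "r dvd to_poly4 f" "r dvd to_poly4 g"
    moreover obtain s where "to_poly4 s = r" using surj_to_poly4 by blast
    ultimately show "r dvd 1"
      using assms(1)[of s] to_poly4_dvd_iff[of s 1] by (auto simp: to_poly4_dvd_iff)
  next
    show "to_poly4 g dvd to_poly4 a * to_poly4 f"
      using assms(2) by (simp flip: poly4.ev_mult add: to_poly4_dvd_iff)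
  next
    show "to_poly4 g \<noteq> 0" using assms(3) inj_to_poly4[of g 0] by auto
  qed
  then show ?thesis by (simp add: to_poly4_dvd_iff)
qed

subsection \<open>Gradings\<close>

text \<open>\<open>bicomp\<close> is the case where \<open>P\<close> fixes the first bidegree; other
  predicates cut out the components for other weights.\<close>

definition restr :: "('a \<Rightarrow> bool) \<Rightarrow> ('a \<Rightarrow>\<^sub>0 'b::zero) \<Rightarrow> 'a \<Rightarrow>\<^sub>0 'b" where
  "restr P F = Poly_Mapping.mapp (\<lambda>m c. if P m then c else 0) F"

lemma lookup_restr: "lookup (restr P F) m = (if P m then lookup F m else 0)"
  by (auto simp: restr_def lookup_mapp in_keys_iff when_def)

lemma keys_restr [simp]: "keys (restr P F) = {m \<in> keys F. P m}"
  by (auto simp: in_keys_iff lookup_restr split: if_splits)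

lemma restr_add: "restr P (F + G) = restr P F + restr P G"
  for F :: "'a \<Rightarrow>\<^sub>0 'b::monoid_add"
  by (rule poly_mapping_eqI) (auto simp: lookup_restr lookup_add)

lemma restr_split: "F = restr P F + restr (\<lambda>m. \<not> P m) F"
  for F :: "'a \<Rightarrow>\<^sub>0 'b::monoid_add"
  by (rule poly_mapping_eqI) (auto simp: lookup_restr lookup_add)

lemma restr_id: "(\<And>m. m \<in> keys F \<Longrightarrow> P m) \<Longrightarrow> restr P F = F"
  by (rule poly_mapping_eqI) (auto simp: lookup_restr in_keys_iff)

lemma restr_eq_0: "(\<And>m. m \<in> keys F \<Longrightarrow> \<not> P m) \<Longrightarrow> restr P F = 0"
  by (rule poly_mapping_eqI) (auto simp: lookup_restr in_keys_iff)

lemma keys_multE: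
  assumes "k \<in> keys (F * G)"
  obtains m n where "m \<in> keys F" "n \<in> keys G" "k = m + n"
  using assms keys_mult[of F G] by auto

text \<open>Only the product of the \<open>Q\<close>-part and the \<open>R\<close>-part satisfies
  \<open>P\<close>; the cross terms die under restriction. Asking this only of monomials that occur
  lets the lemma handle extreme weights.\<close>

lemma restr_mult:
  fixes F G :: "'a::monoid_add \<Rightarrow>\<^sub>0 'b::ring"
  assumes "\<And>m n. m \<in> keys F \<Longrightarrow> n \<in> keys G \<Longrightarrow> P (m + n) \<longleftrightarrow> Q m \<and> R n"
  shows "restr P (F * G) = restr Q F * restr R G"
proof -
  have "F * G = restr Q F * restr R G + (restr Q F * restr (\<lambda>n. \<not> R n) G + restr (\<lambda>m. \<not> Q m) F * G)"
    by (metis (no_types) restr_split distrib_left distrib_right add.assoc)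
  then have "restr P (F * G) = restr P (restr Q F * restr R G) +
    (restr P (restr Q F * restr (\<lambda>n. \<not> R n) G) + restr P (restr (\<lambda>m. \<not> Q m) F * G))"
    by (simp only: restr_add)
  also have "restr P (restr Q F * restr R G) = restr Q F * restr R G"
    by (rule restr_id) (auto elim!: keys_multE simp: assms)
  also have "restr P (restr Q F * restr (\<lambda>n. \<not> R n) G) = 0"
    by (rule restr_eq_0) (auto elim!: keys_multE simp: assms)
  also have "restr P (restr (\<lambda>m. \<not> Q m) F * G) = 0"
    by (rule restr_eq_0) (auto elim!: keys_multE simp: assms)
  finally show ?thesis by simp
qed

text \<open>The weight may have any type, so \<open>tdeg\<close>, \<open>bideg\<close> and its
  coordinates are treated alike. The zero polynomial has every weight.\<close>

definition hom_wt :: "('a \<Rightarrow> 'w) \<Rightarrow> 'w \<Rightarrow> ('a \<Rightarrow>\<^sub>0 'b::zero) \<Rightarrow> bool" where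
  "hom_wt \<omega> i F \<longleftrightarrow> (\<forall>m\<in>keys F. \<omega> m = i)"

definition additive :: "('a::plus \<Rightarrow> 'w::plus) \<Rightarrow> bool" where
  "additive \<omega> \<longleftrightarrow> (\<forall>m n. \<omega> (m + n) = \<omega> m + \<omega> n)"

lemma homogeneous_iff_hom_wt: "homogeneous F d \<longleftrightarrow> hom_wt tdeg d F"
  by (simp add: homogeneous_def hom_wt_def)

lemma additive_tdeg: "additive tdeg"
  by (simp add: additive_def tdeg_def lookup_add)

lemma additive_bideg: "additive bideg"
  by (simp add: additive_def bideg_def lookup_add)

lemma additive_fst_bideg: "additive (\<lambda>m. fst (bideg m))"
  and additive_snd_bideg: "additive (\<lambda>m. snd (bideg m))"
  using additive_bideg by (simp_all add: additive_def)

lemma bideg_sum: "fst (bideg m) + snd (bideg m) = 4 * tdeg m"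
  by (simp add: bideg_def tdeg_def)

lemma hom_wt_single: "\<omega> m = i \<Longrightarrow> hom_wt \<omega> i (single m c)"
  by (simp add: hom_wt_def)

lemma hom_wt_restr: "hom_wt \<omega> i (restr (\<lambda>m. \<omega> m = i) F)"
  by (simp add: hom_wt_def)

lemma hom_wt_restr': "hom_wt \<omega> i F \<Longrightarrow> hom_wt \<omega> i (restr P F)"
  by (simp add: hom_wt_def)

lemma hom_wt_add: "hom_wt \<omega> i F \<Longrightarrow> hom_wt \<omega> i G \<Longrightarrow> hom_wt \<omega> i (F + G)"
  using keys_add[of F G] by (auto simp: hom_wt_def)

lemma hom_wt_diff: "hom_wt \<omega> i F \<Longrightarrow> hom_wt \<omega> i G \<Longrightarrow> hom_wt \<omega> i (F - G)"
  for F G :: "'a \<Rightarrow>\<^sub>0 'b::ab_group_add"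
  by (auto simp: hom_wt_def in_keys_iff lookup_minus)

lemma hom_wt_mult:
  "additive \<omega> \<Longrightarrow> hom_wt \<omega> i F \<Longrightarrow> hom_wt \<omega> j G \<Longrightarrow> hom_wt \<omega> (i + j) (F * G)"
  by (auto simp: hom_wt_def additive_def elim!: keys_multE)

lemma restr_mult_hom:
  fixes A G :: "'a::monoid_add \<Rightarrow>\<^sub>0 'b::ring" and \<omega> :: "'a \<Rightarrow> 'w::cancel_ab_semigroup_add"
  assumes "additive \<omega>" "hom_wt \<omega> j G"
  shows "restr (\<lambda>m. \<omega> m = i + j) (A * G) = restr (\<lambda>m. \<omega> m = i) A * G"
proof -
  have "restr (\<lambda>m. \<omega> m = i + j) (A * G) = restr (\<lambda>m. \<omega> m = i) A * restr (\<lambda>_. True) G"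
    by (rule restr_mult) (use assms in \<open>auto simp: additive_def hom_wt_def\<close>)
  then show ?thesis by (simp add: restr_id)
qed

text \<open>In a domain the products of the lowest parts and of the highest parts are both nonzero,
  so \<open>F * G\<close> has components in both extreme weights. Homogeneity makes these equal,
  hence each factor has only one weight.\<close>

lemma hom_wt_factor:
  fixes F G :: "expo \<Rightarrow>\<^sub>0 'b::idom" and \<omega> :: "expo \<Rightarrow> nat"
  assumes add: "additive \<omega>" and hom: "hom_wt \<omega> k (F * G)" and nz: "F \<noteq> 0" "G \<noteq> 0"
  obtains i j where "hom_wt \<omega> i F" "hom_wt \<omega> j G" "i + j = k"
proof -
  define i j where "i = Min (\<omega> ` keys F)" and "j = Min (\<omega> ` keys G)"
  define i' j' where "i' = Max (\<omega> ` keys F)" and "j' = Max (\<omega> ` keys G)"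
  have ne: "\<omega> ` keys F \<noteq> {}" "\<omega> ` keys G \<noteq> {}" using nz by auto
  have F: "i \<le> \<omega> m" "\<omega> m \<le> i'" if "m \<in> keys F" for m
    using that by (auto simp: i_def i'_def)
  have G: "j \<le> \<omega> m" "\<omega> m \<le> j'" if "m \<in> keys G" for m
    using that by (auto simp: j_def j'_def)
  have attained: "restr (\<lambda>m. \<omega> m = v) H \<noteq> 0" if "v \<in> \<omega> ` keys H" for v and H :: "expo \<Rightarrow>\<^sub>0 'b"
  proof -
    have "keys (restr (\<lambda>m. \<omega> m = v) H) \<noteq> {}" using that by auto
    then show ?thesis by (metis keys_zero)
  qed
  have low: "restr (\<lambda>m. \<omega> m = i + j) (F * G) =
      restr (\<lambda>m. \<omega> m = i) F * restr (\<lambda>m. \<omega> m = j) G"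
    by (rule restr_mult) (use F G add in \<open>fastforce simp: additive_def\<close>)
  have high: "restr (\<lambda>m. \<omega> m = i' + j') (F * G) =
      restr (\<lambda>m. \<omega> m = i') F * restr (\<lambda>m. \<omega> m = j') G"
    by (rule restr_mult) (use F G add in \<open>fastforce simp: additive_def\<close>)
  have "i \<in> \<omega> ` keys F" "j \<in> \<omega> ` keys G" "i' \<in> \<omega> ` keys F" "j' \<in> \<omega> ` keys G"
    using ne by (auto simp: i_def j_def i'_def j'_def intro!: Min_in Max_in)
  then have "restr (\<lambda>m. \<omega> m = i + j) (F * G) \<noteq> 0" "restr (\<lambda>m. \<omega> m = i' + j') (F * G) \<noteq> 0"
    unfolding low high by (auto simp: attained)
  moreover have "restr (\<lambda>m. \<omega> m = v) (F * G) = 0" if "v \<noteq> k" for v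
    using hom that by (intro restr_eq_0) (auto simp: hom_wt_def)
  ultimately have k: "i + j = k" "i' + j' = k" by blast+
  have "i \<le> i'" "j \<le> j'" using ne by (auto simp: i_def i'_def j_def j'_def)
  then have "i = i'" "j = j'" using k by auto
  then have "hom_wt \<omega> i F" "hom_wt \<omega> j G"
    using F G by (auto simp: hom_wt_def intro: antisym)
  then show ?thesis using k(1) by (rule that)
qed

lemma hom_wt_bideg_factor:
  fixes F G :: "'b::idom mpoly4"
  assumes hom: "hom_wt bideg v (F * G)" and nz: "F \<noteq> 0" "G \<noteq> 0"
  obtains i j where "hom_wt bideg i F" "hom_wt bideg j G" "i + j = v"
proof -
  have 1: "hom_wt (\<lambda>m. fst (bideg m)) (fst v) (F * G)" and 2: "hom_wt (\<lambda>m. snd (bideg m)) (snd v) (F * G)"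
    using hom by (auto simp: hom_wt_def)
  obtain i1 j1 where *: "hom_wt (\<lambda>m. fst (bideg m)) i1 F" "hom_wt (\<lambda>m. fst (bideg m)) j1 G" "i1 + j1 = fst v"
    by (rule hom_wt_factor[OF additive_fst_bideg 1 nz])
  obtain i2 j2 where **: "hom_wt (\<lambda>m. snd (bideg m)) i2 F" "hom_wt (\<lambda>m. snd (bideg m)) j2 G" "i2 + j2 = snd v"
    by (rule hom_wt_factor[OF additive_snd_bideg 2 nz])
  show ?thesis
    by (rule that[of "(i1, i2)" "(j1, j2)"]) (use * ** in \<open>auto simp: hom_wt_def prod_eq_iff\<close>)
qed

lemma hom_wt_bideg_tdeg: "hom_wt bideg v F \<Longrightarrow> hom_wt tdeg ((fst v + snd v) div 4) F"
  using bideg_sum by (fastforce simp: hom_wt_def)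

lemma restr_homogeneous_bideg:
  assumes "homogeneous F d"
  shows "hom_wt bideg (i, 4 * d - i) (restr (\<lambda>m. fst (bideg m) = i) F)"
proof -
  have "fst (bideg m) + snd (bideg m) = 4 * d" if "m \<in> keys F" for m
    using assms that bideg_sum[of m] by (simp add: homogeneous_def)
  then show ?thesis
    by (auto simp: hom_wt_def prod_eq_iff) (metis add_diff_cancel_left')
qed

section \<open>Lowest components for a weight\<close>

definition low_part :: "('a \<Rightarrow> nat) \<Rightarrow> ('a \<Rightarrow>\<^sub>0 'b::zero) \<Rightarrow> 'a \<Rightarrow>\<^sub>0 'b" where
  "low_part \<omega> F = restr (\<lambda>m. \<omega> m = Min (\<omega> ` keys F)) F"

lemma low_part_nonzero: "F \<noteq> 0 \<Longrightarrow> low_part \<omega> F \<noteq> 0"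
proof -
  assume "F \<noteq> 0"
  then have "Min (\<omega> ` keys F) \<in> \<omega> ` keys F" by (intro Min_in) auto
  then have "keys (low_part \<omega> F) \<noteq> {}" by (auto simp: low_part_def)
  then show ?thesis by (metis keys_zero)
qed

lemma comp_min_eq_low_part: "comp_min F = low_part (\<lambda>m. fst (bideg m)) F"
  by (simp add: comp_min_def low_part_def bicomp_def imin_def restr_def)

text \<open>The two degrees of a monomial of \<open>F\<close> add up to \<open>4 * d\<close>, so the
  largest first degree goes with the smallest second degree.\<close>

lemma comp_max_eq_low_part:
  assumes "homogeneous F d" "F \<noteq> 0"
  shows "comp_max F = low_part (\<lambda>m. snd (bideg m)) F"
proof -
  let ?f = "\<lambda>m. fst (bideg m)" and ?s = "\<lambda>m. snd (bideg m)"
  have sum: "?f m + ?s m = 4 * d" if "m \<in> keys F" for m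
    using assms that bideg_sum[of m] by (simp add: homogeneous_def)
  have "imax F \<in> ?f ` keys F"
    using assms unfolding imax_def by (intro Max_in) auto
  then obtain m0 where m0: "m0 \<in> keys F" "?f m0 = imax F" by auto
  have le: "?f m \<le> imax F" if "m \<in> keys F" for m
    using that by (auto simp: imax_def)
  have "Min (?s ` keys F) = 4 * d - imax F"
  proof (rule Min_eqI)
    fix y assume "y \<in> ?s ` keys F"
    then show "4 * d - imax F \<le> y" using le sum by fastforce
  next
    show "4 * d - imax F \<in> ?s ` keys F"
      using m0 sum[OF m0(1)] by (intro image_eqI[of _ _ m0]) auto
  qed simp
  then have "?f m = imax F \<longleftrightarrow> ?s m = Min (?s ` keys F)" if "m \<in> keys F" for m
    using sum[OF that] sum[OF m0(1)] m0(2) by linarith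
  then show ?thesis
    by (intro poly_mapping_eqI)
      (auto simp: comp_max_def low_part_def bicomp_def lookup_restr in_keys_iff simp flip: restr_def)
qed

section \<open>Bihomogeneous forms on the curve\<close>

lemma eval4_bihom:
  fixes F :: "'k::comm_ring_1 mpoly4"
  assumes "hom_wt bideg (i, j) F"
  shows "eval4 F (s^4) (s^3 * t) (s * t^3) (t^4) = eval4 F 1 1 1 1 * (s^i * t^j)"
proof -
  have "mon_eval (s^4) (s^3 * t) (s * t^3) (t^4) m = s ^ i * t ^ j" if "m \<in> keys F" for m
  proof -
    have ij: "bideg m = (i, j)" using assms that by (simp add: hom_wt_def)
    have "mon_eval (s^4) (s^3 * t) (s * t^3) (t^4) m = s ^ fst (bideg m) * t ^ snd (bideg m)"
      by (simp add: mon_eval_def bideg_def power_add power_mult_distrib mult_ac flip: power_mult)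
    then show ?thesis by (simp add: ij)
  qed
  then show ?thesis
    by (simp add: eval4_eq_mapping_eval mapping_eval_def sum_distrib_right mon_eval_def)
qed

text \<open>Along the parametrization such a form is its value at \<open>(1, 1, 1, 1)\<close> times
  a monomial in \<open>s\<close> and \<open>t\<close>, so this single point decides.\<close>

lemma bihom_in_macaulay_ideal_iff:
  fixes F :: "'k::comm_ring_1 mpoly4"
  assumes "hom_wt bideg v F"
  shows "F \<in> macaulay_ideal \<longleftrightarrow> eval4 F 1 1 1 1 = 0"
proof
  assume "F \<in> macaulay_ideal"
  then have "eval4 F (1^4) (1^3 * 1) (1 * 1^3) (1^4) = 0"
    unfolding macaulay_ideal_def by blast
  then show "eval4 F 1 1 1 1 = 0" by simp
next
  assume "eval4 F 1 1 1 1 = 0"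
  then show "F \<in> macaulay_ideal"
    using eval4_bihom[of "fst v" "snd v" F] assms by (intro macaulay_idealI) simp
qed

text \<open>At \<open>t = 1\<close> the values of \<open>F\<close> on the curve form a polynomial in
  \<open>s\<close> whose coefficient at \<open>i\<close> is the value of \<open>bicomp F i\<close>
  at \<open>(1, 1, 1, 1)\<close>. It vanishes on an infinite field, so it is zero.\<close>

lemma eval4_bicomp_macaulay_ideal:
  fixes F :: "'k::field_char_0 mpoly4"
  assumes "F \<in> macaulay_ideal"
  shows "eval4 (bicomp F i) 1 1 1 1 = 0"
proof -
  define P where "P = (\<Sum>m\<in>keys F. monom (lookup F m) (fst (bideg m)))"
  have "poly P s = 0" for s
  proof -
    have "mon_eval (s^4) (s^3 * 1) (s * 1^3) (1^4) m = s ^ fst (bideg m)" for m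
      by (simp add: mon_eval_def bideg_def power_add mult_ac flip: power_mult)
    then have "poly P s = eval4 F (s^4) (s^3 * 1) (s * 1^3) (1^4)"
      by (simp add: P_def poly_sum poly_monom eval4_eq_mapping_eval mapping_eval_def)
    moreover have "eval4 F (s^4) (s^3 * 1) (s * 1^3) (1^4) = 0"
      using assms unfolding macaulay_ideal_def by blast
    ultimately show ?thesis by simp
  qed
  then have "P = 0" using poly_all_0_iff_0 by blast
  then have "coeff P i = 0" by simp
  then have "0 = (\<Sum>m\<in>keys F. if fst (bideg m) = i then lookup F m else 0)"
    by (simp add: P_def coeff_sum)
  also have "\<dots> = (\<Sum>m\<in>{m \<in> keys F. fst (bideg m) = i}. lookup F m)"
    by (rule sum.inter_filter[symmetric]) simp
  also have "\<dots> = eval4 (bicomp F i) 1 1 1 1"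
    by (auto simp: eval4_def bicomp_def lookup_restr simp flip: restr_def intro!: sum.cong)
  finally show ?thesis by simp
qed

subsection \<open>Sylvester determinants of families of polynomials\<close>

text \<open>The rows of the Sylvester matrix as shifted copies of \<open>F\<close> and
  \<open>G\<close>. Here \<open>m\<close> and \<open>n\<close> are formal degrees, which keep the
  size of the matrix fixed when coefficients are specialised.\<close>

definition sylvester_row :: "nat \<Rightarrow> nat \<Rightarrow> 'a::comm_semiring_1 poly \<Rightarrow> 'a poly \<Rightarrow> nat \<Rightarrow> 'a poly" where
  "sylvester_row m n F G i = (if i < n then monom 1 (n - 1 - i) * F else monom 1 (m + n - 1 - i) * G)"

lemma sylvester_mat_sub_eq_coeff_row:
  fixes F G :: "'a::comm_semiring_1 poly"
  assumes "degree F \<le> m" "degree G \<le> n" "i < m + n" "j < m + n"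
  shows "sylvester_mat_sub m n F G $$ (i, j) = coeff (sylvester_row m n F G i) (m + n - 1 - j)"
proof (cases "i < n")
  case True
  have "m + n - 1 - j - (n - 1 - i) = m + i - j" if "n - 1 - i \<le> m + n - 1 - j"
    using True that assms by linarith
  moreover have "coeff F (m + i - j) = 0" if "\<not> i \<le> j"
    using that assms by (intro coeff_eq_0) linarith
  ultimately show ?thesis
    using True assms by (auto simp: sylvester_mat_sub_index sylvester_row_def coeff_monom_mult)
next
  case False
  have "m + n - 1 - j - (m + n - 1 - i) = i - j" if "j \<le> i"
    using False that assms by linarith
  moreover have "coeff G (i - j) = 0" if "\<not> i - n \<le> j"
    using that assms by (intro coeff_eq_0) linarith
  ultimately show ?thesis
    using False assms by (auto simp: sylvester_mat_sub_index sylvester_row_def coeff_monom_mult)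
qed

lemma degree_sylvester_row:
  fixes F G :: "'a::comm_semiring_1 poly"
  assumes "degree F \<le> m" "degree G \<le> n" "i < m + n"
  shows "degree (sylvester_row m n F G i) < m + n"
proof (cases "i < n")
  case True
  have "degree (monom 1 (n - 1 - i) * F) \<le> (n - 1 - i) + m"
    using degree_mult_le[of "monom 1 (n - 1 - i)" F] degree_monom_le[of "1::'a" "n - 1 - i"] assms by linarith
  then show ?thesis using True assms by (simp add: sylvester_row_def)
next
  case False
  have "degree (monom 1 (m + n - 1 - i) * G) \<le> (m + n - 1 - i) + n"
    using degree_mult_le[of "monom 1 (m + n - 1 - i)" G] degree_monom_le[of "1::'a" "m + n - 1 - i"] assms by linarith
  then show ?thesis using False assms by (simp add: sylvester_row_def)
qed

text \<open>Each row is a multiple of \<open>F\<close> or \<open>G\<close>, so the vector of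
  descending powers of \<open>u\<close> lies in the kernel.\<close>

lemma det_sylvester_eq_0_if_common_root:
  fixes F G :: "'a::field poly"
  assumes "degree F \<le> m" "degree G \<le> n" "0 < m + n" "poly F u = 0" "poly G u = 0"
  shows "det (sylvester_mat_sub m n F G) = 0"
proof -
  let ?A = "sylvester_mat_sub m n F G" and ?N = "m + n"
  let ?v = "vec ?N (\<lambda>j. u ^ (?N - 1 - j))"
  have "?A *\<^sub>v ?v = 0\<^sub>v ?N"
  proof (rule eq_vecI)
    fix i assume i: "i < dim_vec (0\<^sub>v ?N)"
    let ?R = "sylvester_row m n F G i"
    have "(?A *\<^sub>v ?v) $ i = (\<Sum>j<?N. coeff ?R (?N - 1 - j) * u ^ (?N - 1 - j))"
      using i assms
      by (auto simp: scalar_prod_def sylvester_mat_sub_eq_coeff_row atLeast0LessThan intro!: sum.cong)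
    also have "\<dots> = (\<Sum>j<?N. coeff ?R j * u ^ j)"
      by (rule sum.reindex_bij_witness[of _ "\<lambda>j. ?N - 1 - j" "\<lambda>j. ?N - 1 - j"]) auto
    also have "\<dots> = (\<Sum>j\<le>degree ?R. coeff ?R j * u ^ j)"
      by (rule sum.mono_neutral_right)
        (use degree_sylvester_row[of F m G n i] i assms in \<open>auto simp: coeff_eq_0\<close>)
    also have "\<dots> = poly ?R u" by (simp add: poly_altdef)
    also have "\<dots> = 0" using assms by (simp add: sylvester_row_def)
    finally show "(?A *\<^sub>v ?v) $ i = 0\<^sub>v ?N $ i" using i by simp
  qed auto
  \<comment> \<open>The last entry is \<open>u ^ 0 = 1\<close>, even for
    \<open>u = 0\<close>.\<close>
  moreover have "?v \<noteq> 0\<^sub>v ?N"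
  proof
    assume "?v = 0\<^sub>v ?N"
    then have "?v $ (?N - 1) = 0\<^sub>v ?N $ (?N - 1)" by simp
    then show False using assms by simp
  qed
  ultimately show ?thesis
    using det_0_iff_vec_prod_zero[OF sylvester_mat_sub_carrier] by (meson vec_carrier)
qed

text \<open>A left kernel vector encodes a relation \<open>\<alpha> * F + \<beta> * G = 0\<close>
  with \<open>\<alpha>\<close> zero or of degree below \<open>n\<close>. Without common roots
  \<open>F\<close> and \<open>G\<close> are coprime, so \<open>G\<close> divides
  \<open>\<alpha>\<close>, which forces \<open>\<alpha> = 0\<close> and then
  \<open>\<beta> = 0\<close>. This needs the exact degree of \<open>G\<close>, while
  \<open>m\<close> only bounds that of \<open>F\<close>.\<close>

lemma det_sylvester_nonzero:
  fixes F G :: "'a::field poly"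
  assumes closed: "alg_closed_field TYPE('a)"
    and deg: "degree F \<le> m" "degree G = n" and G: "G \<noteq> 0"
    and no_root: "\<And>u. \<not> (poly F u = 0 \<and> poly G u = 0)"
  shows "det (sylvester_mat_sub m n F G) \<noteq> 0"
proof
  let ?A = "sylvester_mat_sub m n F G" and ?N = "m + n"
  assume "det ?A = 0"
  then have "det (transpose_mat ?A) = 0"
    by (simp add: det_transpose[OF sylvester_mat_sub_carrier])
  then obtain w where w: "w \<in> carrier_vec ?N" "w \<noteq> 0\<^sub>v ?N" "transpose_mat ?A *\<^sub>v w = 0\<^sub>v ?N"
    using det_0_iff_vec_prod_zero[OF transpose_carrier_mat[THEN iffD2, OF sylvester_mat_sub_carrier]]
    by blast
  let ?R = "sylvester_row m n F G"
  \<comment> \<open>The first \<open>n\<close> entries of \<open>w\<close> are the coefficients of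
    \<open>\<alpha>\<close>, the last \<open>m\<close> those of \<open>\<beta>\<close>.\<close>
  define \<alpha> where "\<alpha> = (\<Sum>i<n. monom (w $ i) (n - 1 - i))"
  define \<beta> where "\<beta> = (\<Sum>i\<in>{n..<?N}. monom (w $ i) (?N - 1 - i))"
  have comb: "\<alpha> * F + \<beta> * G = (\<Sum>i<?N. Polynomial.smult (w $ i) (?R i))"
  proof -
    have "(\<Sum>i<?N. Polynomial.smult (w $ i) (?R i)) = (\<Sum>i<n. Polynomial.smult (w $ i) (?R i)) + (\<Sum>i\<in>{n..<?N}. Polynomial.smult (w $ i) (?R i))"
      using sum.atLeastLessThan_concat[of 0 n ?N "\<lambda>i. Polynomial.smult (w $ i) (?R i)"] by (simp add: atLeast0LessThan)
    moreover have "(\<Sum>i<n. Polynomial.smult (w $ i) (?R i)) = \<alpha> * F"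
      unfolding \<alpha>_def sum_distrib_right
      by (rule sum.cong) (auto simp: sylvester_row_def smult_monom simp flip: mult_smult_left)
    moreover have "(\<Sum>i\<in>{n..<?N}. Polynomial.smult (w $ i) (?R i)) = \<beta> * G"
      unfolding \<beta>_def sum_distrib_right
      by (rule sum.cong) (auto simp: sylvester_row_def smult_monom simp flip: mult_smult_left)
    ultimately show ?thesis by simp
  qed
  have zero: "\<alpha> * F + \<beta> * G = 0"
  proof (rule poly_eqI)
    fix k
    show "coeff (\<alpha> * F + \<beta> * G) k = coeff 0 k"
    proof (cases "k < ?N")
      case True
      let ?j = "?N - 1 - k"
      have "0 = (transpose_mat ?A *\<^sub>v w) $ ?j" using w True by simp
      also have "\<dots> = (\<Sum>i<?N. ?A $$ (i, ?j) * w $ i)"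
        using True w(1) by (auto simp: scalar_prod_def atLeast0LessThan intro!: sum.cong)
      also have "\<dots> = (\<Sum>i<?N. w $ i * coeff (?R i) k)"
        using True deg by (auto simp: sylvester_mat_sub_eq_coeff_row intro!: sum.cong)
      finally show ?thesis by (simp add: comb coeff_sum)
    next
      case False
      then have "coeff (?R i) k = 0" if "i < ?N" for i
        using degree_sylvester_row[of F m G n i] that deg by (intro coeff_eq_0) auto
      then show ?thesis by (simp add: comb coeff_sum)
    qed
  qed
  have "G dvd \<alpha>"
  proof (rule ufd_coprime_dvd_mult[of F G \<alpha>])
    fix r assume r: "r dvd F" "r dvd G"
    show "r dvd 1"
    proof (cases "degree r = 0")
      case True
      then obtain c where "r = [:c:]" using degree_eq_zeroE by blast
      moreover have "r \<noteq> 0" using r(2) G by auto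
      ultimately show ?thesis by (simp add: is_unit_const_poly_iff dvd_field_iff)
    next
      case False
      then obtain u where "poly r u = 0" using closed by (auto simp: alg_closed_field_def)
      then have "poly F u = 0" "poly G u = 0" using r by (auto elim!: dvdE)
      then show ?thesis using no_root by blast
    qed
  next
    have "\<alpha> * F = G * (- \<beta>)" using zero by (simp add: eq_neg_iff_add_eq_0 mult.commute)
    then show "G dvd \<alpha> * F" by simp
  qed (rule G)
  moreover have "degree \<alpha> < n \<or> \<alpha> = 0"
  proof (cases "n = 0")
    case False
    have "degree \<alpha> \<le> n - 1" unfolding \<alpha>_def
      by (rule degree_sum_le) (auto intro: order.trans[OF degree_monom_le])
    then show ?thesis using False by linarith
  qed (simp add: \<alpha>_def)
  ultimately have \<alpha>: "\<alpha> = 0" using dvd_imp_degree_le[of G \<alpha>] deg by linarith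
  then have \<beta>: "\<beta> = 0" using zero G by simp
  have "w $ i = 0" if i: "i < ?N" for i
  proof (cases "i < n")
    case True
    have "0 = (\<Sum>k<n. if k = i then w $ k else 0)"
    proof -
      have "0 = coeff \<alpha> (n - 1 - i)" using \<alpha> by simp
      also have "\<dots> = (\<Sum>k<n. if k = i then w $ k else 0)"
        using True unfolding \<alpha>_def coeff_sum by (intro sum.cong) auto
      finally show ?thesis .
    qed
    then show ?thesis using True by simp
  next
    case False
    have "0 = (\<Sum>k\<in>{n..<?N}. if k = i then w $ k else 0)"
    proof -
      have "0 = coeff \<beta> (?N - 1 - i)" using \<beta> by simp
      also have "\<dots> = (\<Sum>k\<in>{n..<?N}. if k = i then w $ k else 0)"
        using False i unfolding \<beta>_def coeff_sum by (intro sum.cong) auto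
      finally show ?thesis .
    qed
    then show ?thesis using False i by simp
  qed
  then have "w = 0\<^sub>v ?N" using w(1) by (intro eq_vecI) auto
  then show False using w(2) by simp
qed

lemma det_cong:
  fixes A B :: "'a::field poly mat"
  assumes "A \<in> carrier_mat n n" "B \<in> carrier_mat n n"
    and "\<And>i j. i < n \<Longrightarrow> j < n \<Longrightarrow> [A $$ (i, j) = B $$ (i, j)] (mod d)"
  shows "[det A = det B] (mod d)"
proof -
  have "[(\<Sum>p | p permutes {0..<n}. signof p * (\<Prod>i = 0..<n. A $$ (i, p i))) =
    (\<Sum>p | p permutes {0..<n}. signof p * (\<Prod>i = 0..<n. B $$ (i, p i)))] (mod d)"
    by (intro cong_sum cong_mult cong_prod cong_refl assms(3)) (auto dest: permutes_in_image)
  then show ?thesis using assms(1,2) by (simp add: det_def)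
qed

text \<open>The formal degrees stay fixed, so specialisation commutes with the determinant even
  where leading coefficients vanish.\<close>

lemma poly_det_sylvester:
  fixes F G :: "'a::field poly poly"
  shows "poly (det (sylvester_mat_sub m n F G)) a =
    det (sylvester_mat_sub m n (map_poly (\<lambda>q. poly q a) F) (map_poly (\<lambda>q. poly q a) G))"
  by (simp flip: comm_ring_hom.hom_det[OF poly_hom.comm_ring_hom_axioms] add: sylvester_mat_sub_map)

subsection \<open>The bihomogeneous case\<close>

text \<open>The restriction to \<open>(1, 1, u, \<epsilon> * u)\<close>, as a polynomial in
  \<open>u\<close> whose coefficients are polynomials in \<open>\<epsilon>\<close>.\<close>

definition slice :: "'k::field mpoly4 \<Rightarrow> 'k poly poly" where
  "slice F = (\<Sum>m\<in>keys F. monom (monom (lookup F m) (lookup m Z)) (lookup m Y + lookup m Z))"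

lemma map_poly_slice:
  "map_poly (\<lambda>q. poly q a) (slice F) = (\<Sum>m\<in>keys F. monom (lookup F m * a ^ lookup m Z) (lookup m Y + lookup m Z))"
  by (rule poly_eqI) (auto simp: coeff_map_poly slice_def coeff_sum poly_sum poly_monom intro!: sum.cong)

lemma poly_slice: "poly (map_poly (\<lambda>q. poly q a) (slice F)) u = eval4 F 1 1 u (a * u)"
  by (simp add: map_poly_slice poly_sum poly_monom eval4_def power_add power_mult_distrib mult_ac)

lemma no_roots_imp_const:
  fixes r :: "'k::field poly"
  assumes "alg_closed_field TYPE('k)" "\<And>a. poly r a \<noteq> 0"
  obtains c where "r = [:c:]" "c \<noteq> 0"
proof -
  have "degree r = 0" using assms by (auto simp: alg_closed_field_def)
  then obtain c where "r = [:c:]" using degree_eq_zeroE by blast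
  then show ?thesis using that assms(2)[of 0] by auto
qed

text \<open>Characteristic zero enters here: \<open>c (x - 1) ^ n\<close> has nonzero linear coefficient.\<close>

lemma single_root_linear_coeff:
  fixes r :: "'k::field_char_0 poly"
  assumes "alg_closed_field TYPE('k)" "poly r 1 = 0" "\<And>a. poly r a = 0 \<Longrightarrow> a = 1" "r \<noteq> 0"
  shows "coeff r 1 \<noteq> 0"
proof -
  obtain q where q: "r = [:-1, 1:] ^ Polynomial.order 1 r * q" "\<not> [:-1, 1:] dvd q"
    using order_decomp[OF assms(4), of 1] by auto
  have "poly q a \<noteq> 0" for a
  proof
    assume "poly q a = 0"
    moreover from this have "a = 1" using assms(3)[of a] q(1) by (metis mult_zero_right poly_mult)
    ultimately show False using q(2) by (simp add: poly_eq_0_iff_dvd)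
  qed
  then obtain c where c: "q = [:c:]" "c \<noteq> 0" using no_roots_imp_const[OF assms(1)] by metis
  obtain n where n: "Polynomial.order 1 r = Suc n"
    using assms(2,4) by (metis order_root not0_implies_Suc)
  have "pderiv r = pderiv ([:-1, 1:] ^ Suc n) * q"
    unfolding q(1)[unfolded n] c(1) pderiv_mult by (simp add: pderiv_pCons)
  then have "poly (pderiv r) 0 = of_nat (Suc n) * (-1) ^ n * c"
    using c by (simp add: pderiv_power_Suc pderiv_pCons del: of_nat_Suc power_Suc)
  then have "poly (pderiv r) 0 \<noteq> 0" using c by (simp del: of_nat_Suc)
  then show ?thesis by (simp add: poly_0_coeff_0 coeff_pderiv)
qed

text \<open>No monomial of bidegree \<open>(d, 3 d)\<close> is divisible by \<open>z\<close> exactly once; this is special to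
  the exponents \<open>4, 3, 1, 0\<close>.\<close>

lemma bideg_y_power:
  assumes "bideg m = (d, 3 * d)" "m \<noteq> expo4 0 0 d 0"
  shows "lookup m Z \<ge> 2 \<and> lookup m Y + lookup m Z < d"
proof -
  have eq: "lookup m Z = 3 * lookup m W + 2 * lookup m X" "lookup m Y + 4 * lookup m W + 3 * lookup m X = d"
    using assms(1) by (auto simp: bideg_def)
  have "lookup m W \<noteq> 0 \<or> lookup m X \<noteq> 0"
    using assms(2) expo_eqI[of m "expo4 0 0 d 0"] eq by auto
  then show ?thesis using eq by linarith
qed

text \<open>The resultant \<open>r\<close> of the slices vanishes at \<open>\<epsilon> = 1\<close>
  only, since common zeros satisfy \<open>\<epsilon> * u = u\<close> with
  \<open>u \<noteq> 0\<close>. Replacing \<open>g\<close> by its pure power of \<open>y\<close>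
  changes \<open>r\<close> by a multiple of \<open>\<epsilon> ^ 2\<close> and yields a nonzero
  constant \<open>r0\<close>. So \<open>r\<close> has no linear term, against
  \<open>single_root_linear_coeff\<close>.\<close>

lemma no_bihom_pair_aux:
  fixes f g :: "'k::field_char_0 mpoly4"
  assumes closed: "alg_closed_field TYPE('k)"
    and f: "hom_wt bideg (3 * d1, d1) f" "lookup f (expo4 0 d1 0 0) \<noteq> 0" "eval4 f 1 1 1 1 = 0"
    and g: "hom_wt bideg (d2, 3 * d2) g" "lookup g (expo4 0 0 d2 0) \<noteq> 0" "eval4 g 1 1 1 1 = 0"
    and zeros: "\<And>c e. eval4 f 1 1 c e = 0 \<Longrightarrow> eval4 g 1 1 c e = 0 \<Longrightarrow> e = c"
  shows False
proof -
  define F G where "F = slice f" and "G = slice g"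
  define \<gamma> where "\<gamma> = lookup g (expo4 0 0 d2 0)"
  define G0 where "G0 = monom [:\<gamma>:] d2"
  define M where "M = degree F"
  define r r0 where "r = det (sylvester_mat_sub M d2 F G)" and "r0 = det (sylvester_mat_sub M d2 F G0)"
  let ?at = "\<lambda>a. map_poly (\<lambda>q. poly q a)"
  have Fat: "poly (?at a F) u = eval4 f 1 1 u (a * u)" and Gat: "poly (?at a G) u = eval4 g 1 1 u (a * u)" for a u
    by (simp_all add: F_def G_def poly_slice)
  \<comment> \<open>At \<open>u = 0\<close> only \<open>x ^ d1\<close> survives, so \<open>0\<close>
    is never a root of the slice of \<open>f\<close>.\<close>
  have F0: "poly (?at a F) 0 \<noteq> 0" for a
  proof -
    have "mon_eval 1 1 0 0 m = (if m = expo4 0 d1 0 0 then 1 else 0 :: 'k)" if "m \<in> keys f" for m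
    proof -
      have "bideg m = (3 * d1, d1)" using f(1) that by (simp add: hom_wt_def)
      then have "m = expo4 0 d1 0 0" if "lookup m Y = 0" "lookup m Z = 0"
        using that by (intro expo_eqI) (auto simp: bideg_def)
      then show ?thesis
        by (cases "m = expo4 0 d1 0 0") (auto simp: mon_eval_def power_0_left)
    qed
    then have "eval4 f 1 1 0 0 = (\<Sum>m\<in>keys f. if m = expo4 0 d1 0 0 then lookup f m else 0)"
      unfolding eval4_eq_mapping_eval mapping_eval_def by (intro sum.cong) auto
    then have "eval4 f 1 1 0 (a * 0) \<noteq> 0" using f(2) by (simp add: in_keys_iff)
    then show ?thesis unfolding Fat .
  qed
  have coeff_G: "coeff G k = coeff G0 k + (\<Sum>m\<in>keys g - {expo4 0 0 d2 0}.
      if lookup m Y + lookup m Z = k then monom (lookup g m) (lookup m Z) else 0)" for k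
  proof -
    have "expo4 0 0 d2 0 \<in> keys g" using g(2) by (simp add: in_keys_iff)
    then show ?thesis
      unfolding G_def slice_def coeff_sum G0_def \<gamma>_def
      by (subst sum.remove[of _ "expo4 0 0 d2 0"]) (auto simp: monom_0)
  qed
  have others: "lookup m Z \<ge> 2" "lookup m Y + lookup m Z < d2" if "m \<in> keys g - {expo4 0 0 d2 0}" for m
    using bideg_y_power[of m d2] g(1) that by (auto simp: hom_wt_def)
  have top: "coeff G k = coeff G0 k" if "k \<ge> d2" for k
  proof -
    have "lookup m Y + lookup m Z \<noteq> k" if "m \<in> keys g - {expo4 0 0 d2 0}" for m
      using others(2)[OF that] \<open>k \<ge> d2\<close> by simp
    then show ?thesis unfolding coeff_G by simp
  qed
  have \<gamma>: "\<gamma> \<noteq> 0" using g(2) by (simp add: \<gamma>_def)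
  have deg_le: "degree (?at a F) \<le> M" for a
    by (simp add: M_def degree_map_poly_le)
  \<comment> \<open>The leading coefficient is the constant \<open>\<gamma>\<close>, so no value of
    \<open>\<epsilon>\<close> lowers the degree, as \<open>det_sylvester_nonzero\<close>
    requires.\<close>
  have deg_at: "degree (?at a H) = d2" "?at a H \<noteq> 0"
    if H: "\<And>k. k \<ge> d2 \<Longrightarrow> coeff H k = coeff G0 k" for a H
  proof -
    have *: "coeff (?at a H) k = (if k = d2 then \<gamma> else 0)" if k: "k \<ge> d2" for k
      using H[OF k] by (auto simp: coeff_map_poly G0_def)
    show "degree (?at a H) = d2"
      by (rule antisym[OF degree_le le_degree]) (use * \<gamma> in auto)
    show "?at a H \<noteq> 0"
    proof
      assume "?at a H = 0"
      then have "coeff (?at a H) d2 = 0" by (simp only: coeff_0)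
      then show False using *[of d2] \<gamma> by simp
    qed
  qed
  have r0_nz: "poly r0 a \<noteq> 0" for a
  proof -
    have "\<not> (poly (?at a F) u = 0 \<and> poly (?at a G0) u = 0)" for u
    proof (cases "u = 0")
      case False
      have "?at a G0 = monom \<gamma> d2"
        by (rule poly_eqI) (auto simp: G0_def coeff_map_poly)
      then show ?thesis using False \<gamma> by (simp add: poly_monom)
    qed (use F0 in simp)
    then show ?thesis
      unfolding r0_def poly_det_sylvester
      by (intro det_sylvester_nonzero closed deg_le deg_at) auto
  qed
  then obtain \<delta> where \<delta>: "r0 = [:\<delta>:]" "\<delta> \<noteq> 0" using no_roots_imp_const[OF closed] by metis
  have r_root: "a = 1" if "poly r a = 0" for a
  proof (rule ccontr)
    assume "a \<noteq> 1"
    have "\<not> (poly (?at a F) u = 0 \<and> poly (?at a G) u = 0)" for u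
    proof
      assume *: "poly (?at a F) u = 0 \<and> poly (?at a G) u = 0"
      then have "a * u = u" using zeros[of u "a * u"] by (simp add: Fat Gat)
      then have "u = 0" using \<open>a \<noteq> 1\<close> by simp
      then show False using * F0 by simp
    qed
    then have "poly r a \<noteq> 0"
      unfolding r_def poly_det_sylvester
      by (intro det_sylvester_nonzero closed deg_le deg_at top) auto
    then show False using that by simp
  qed
  have r1: "poly r 1 = 0"
  proof -
    \<comment> \<open>A constant slice of \<open>f\<close> would vanish at \<open>u = 0\<close> as
      it does at \<open>u = 1\<close>. Positivity of \<open>M\<close> makes the Sylvester matrix
      nonempty.\<close>
    have "0 < M"
    proof (rule ccontr)
      assume "\<not> 0 < M"
      then have "degree (?at 1 F) = 0" using deg_le[of 1] by simp
      then obtain c where "?at 1 F = [:c:]" using degree_eq_zeroE by blast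
      then show False using F0[of 1] Fat[of 1 1] f(3) by simp
    qed
    moreover have "poly (?at 1 F) 1 = 0" "poly (?at 1 G) 1 = 0"
      unfolding Fat Gat using f(3) g(3) by simp_all
    ultimately show ?thesis
      unfolding r_def poly_det_sylvester using deg_at(1)[of G 1, OF top]
      by (intro det_sylvester_eq_0_if_common_root[where u = 1] deg_le) simp_all
  qed
  have "[r = r0] (mod monom 1 2)"
    unfolding r_def r0_def
  proof (rule det_cong[OF sylvester_mat_sub_carrier sylvester_mat_sub_carrier])
    fix i j assume ij: "i < M + d2" "j < M + d2"
    have "[coeff G k = coeff G0 k] (mod monom 1 2)" for k
    proof -
      have "monom 1 2 dvd monom (lookup g m) (lookup m Z)" if "m \<in> keys g - {expo4 0 0 d2 0}" for m
        using others(1)[OF that]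
        by (intro dvdI[of _ _ "monom (lookup g m) (lookup m Z - 2)"]) (simp add: mult_monom del: add_2_eq_Suc)
      then have "monom 1 2 dvd coeff G k - coeff G0 k"
        unfolding coeff_G add_diff_cancel_left' by (intro dvd_sum) simp
      then show ?thesis by (simp add: cong_iff_dvd_diff)
    qed
    then show "[sylvester_mat_sub M d2 F G $$ (i, j) = sylvester_mat_sub M d2 F G0 $$ (i, j)] (mod monom 1 2)"
      using ij by (auto simp: sylvester_mat_sub_index)
  qed
  then obtain q where q: "r - r0 = monom 1 2 * q" by (auto simp: cong_iff_dvd_diff elim: dvdE)
  have "coeff r k = coeff r0 k" if "k < 2" for k
    using that arg_cong[OF q, of "\<lambda>p. coeff p k"] by (simp add: coeff_monom_mult)
  from this[of 0] this[of 1] have "coeff r 0 \<noteq> 0" "coeff r 1 = 0" using \<delta> by simp_all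
  moreover from this have "r \<noteq> 0" by (metis coeff_0)
  ultimately show False using single_root_linear_coeff[OF closed r1 r_root] by blast
qed

text \<open>A pure power of \<open>x\<close> and a pure power of \<open>y\<close> must occur among the monomials of \<open>f\<close> and \<open>g\<close>,
  and bihomogeneity forbids both of them to occur in the same polynomial.\<close>

lemma no_bihom_pair:
  fixes f g :: "'k::field_char_0 mpoly4"
  assumes closed: "alg_closed_field TYPE('k)"
    and f: "hom_wt bideg v f" "hom_wt tdeg d1 f" "eval4 f 1 1 1 1 = 0"
    and g: "hom_wt bideg v' g" "hom_wt tdeg d2 g" "eval4 g 1 1 1 1 = 0"
    and zeros: "\<And>a b c e. eval4 f a b c e = 0 \<Longrightarrow> eval4 g a b c e = 0 \<Longrightarrow>
      a * e = b * c \<and> b ^ 3 = a ^ 2 * c \<and> c ^ 3 = b * e ^ 2"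
  shows False
proof -
  \<comment> \<open>The value of a form at a coordinate point is its coefficient at the pure power
    of that variable.\<close>
  have X: "lookup F (expo4 0 d 0 0) \<noteq> 0" if "eval4 F 0 1 0 0 \<noteq> 0" "hom_wt tdeg d F"
    for F :: "'k mpoly4" and d
  proof -
    have "mon_eval 0 1 0 0 m = (if m = expo4 0 d 0 0 then 1 else 0 :: 'k)" if "m \<in> keys F" for m
    proof -
      have "tdeg m = d" using \<open>hom_wt tdeg d F\<close> that by (simp add: hom_wt_def)
      then have "m = expo4 0 d 0 0" if "lookup m W = 0" "lookup m Y = 0" "lookup m Z = 0"
        using that by (intro expo_eqI) (auto simp: tdeg_def)
      then show ?thesis
        by (cases "m = expo4 0 d 0 0") (auto simp: mon_eval_def power_0_left)
    qed
    then have "eval4 F 0 1 0 0 = (\<Sum>m\<in>keys F. if m = expo4 0 d 0 0 then lookup F m else 0)"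
      unfolding eval4_eq_mapping_eval mapping_eval_def by (intro sum.cong) auto
    then show ?thesis using that(1) by (simp split: if_splits)
  qed
  have Y: "lookup F (expo4 0 0 d 0) \<noteq> 0" if "eval4 F 0 0 1 0 \<noteq> 0" "hom_wt tdeg d F"
    for F :: "'k mpoly4" and d
  proof -
    have "mon_eval 0 0 1 0 m = (if m = expo4 0 0 d 0 then 1 else 0 :: 'k)" if "m \<in> keys F" for m
    proof -
      have "tdeg m = d" using \<open>hom_wt tdeg d F\<close> that by (simp add: hom_wt_def)
      then have "m = expo4 0 0 d 0" if "lookup m W = 0" "lookup m X = 0" "lookup m Z = 0"
        using that by (intro expo_eqI) (auto simp: tdeg_def)
      then show ?thesis
        by (cases "m = expo4 0 0 d 0") (auto simp: mon_eval_def power_0_left)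
    qed
    then have "eval4 F 0 0 1 0 = (\<Sum>m\<in>keys F. if m = expo4 0 0 d 0 then lookup F m else 0)"
      unfolding eval4_eq_mapping_eval mapping_eval_def by (intro sum.cong) auto
    then show ?thesis using that(1) by (simp split: if_splits)
  qed
  have bideg_X: "hom_wt bideg (3 * d, d) F" if "lookup F (expo4 0 d 0 0) \<noteq> 0" "hom_wt bideg v F"
    for F :: "'k mpoly4" and d v
  proof -
    have "bideg (expo4 0 d 0 0) = v" using that by (simp add: hom_wt_def in_keys_iff)
    then show ?thesis using that(2) by (auto simp: bideg_def)
  qed
  have bideg_Y: "hom_wt bideg (d, 3 * d) F" if "lookup F (expo4 0 0 d 0) \<noteq> 0" "hom_wt bideg v F"
    for F :: "'k mpoly4" and d v
  proof -
    have "bideg (expo4 0 0 d 0) = v" using that by (simp add: hom_wt_def in_keys_iff)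
    then show ?thesis using that(2) by (auto simp: bideg_def)
  qed
  \<comment> \<open>The bidegrees \<open>(3 * d, d)\<close> and \<open>(d, 3 * d)\<close> agree only
    for \<open>d = 0\<close>; then \<open>F\<close> is a nonzero constant and cannot vanish at
    \<open>(1, 1, 1, 1)\<close>.\<close>
  have not_both: False if F: "lookup F (expo4 0 d 0 0) \<noteq> 0" "lookup F (expo4 0 0 d 0) \<noteq> 0"
    "hom_wt bideg v F" "hom_wt tdeg d F" "eval4 F 1 1 1 1 = 0" for F :: "'k mpoly4" and d v
  proof -
    have "bideg (expo4 0 d 0 0) = v" "bideg (expo4 0 0 d 0) = v"
      using F by (auto simp: hom_wt_def in_keys_iff)
    then have "d = 0" by (auto simp: bideg_def)
    then have "m = 0" if "m \<in> keys F" for m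
      using F(4) that by (intro expo_eqI) (auto simp: hom_wt_def tdeg_def)
    moreover have "expo4 0 0 0 0 = 0" by (intro expo_eqI) auto
    ultimately have "keys F = {0}" using F(1) \<open>d = 0\<close> by (auto simp: in_keys_iff)
    then show False using F(1,5) \<open>d = 0\<close> \<open>expo4 0 0 0 0 = 0\<close> by (simp add: eval4_def)
  qed
  \<comment> \<open>The points \<open>(0, 1, 0, 0)\<close> and \<open>(0, 0, 1, 0)\<close> violate
    the equations in \<open>zeros\<close>.\<close>
  have fX: "eval4 f 0 1 0 0 \<noteq> 0 \<or> eval4 g 0 1 0 0 \<noteq> 0" using zeros[of 0 1 0 0] by auto
  have fY: "eval4 f 0 0 1 0 \<noteq> 0 \<or> eval4 g 0 0 1 0 \<noteq> 0" using zeros[of 0 0 1 0] by auto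
  consider "lookup f (expo4 0 d1 0 0) \<noteq> 0" "lookup g (expo4 0 0 d2 0) \<noteq> 0"
    | "lookup g (expo4 0 d2 0 0) \<noteq> 0" "lookup f (expo4 0 0 d1 0) \<noteq> 0"
    using fX fY X Y f g not_both by blast
  then show False
  proof cases
    case 1
    show False
      by (rule no_bihom_pair_aux[OF closed bideg_X[OF 1(1) f(1)] 1(1) f(3) bideg_Y[OF 1(2) g(1)] 1(2) g(3)])
        (use zeros[of 1 1] in auto)
  next
    case 2
    show False
      by (rule no_bihom_pair_aux[OF closed bideg_X[OF 2(1) g(1)] 2(1) g(3) bideg_Y[OF 2(2) f(1)] 2(2) f(3)])
        (use zeros[of 1 1] in auto)
  qed
qed

subsection \<open>Coprime lowest components\<close>

lemma ideal2I: "h = a * f + b * g \<Longrightarrow> h \<in> ideal2 f g"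
  by (auto simp: ideal2_def)

lemma ideal2E:
  assumes "h \<in> ideal2 f g"
  obtains a b where "h = a * f + b * g"
  using assms by (auto simp: ideal2_def)

lemma low_part_le: "m \<in> keys F \<Longrightarrow> Min (\<omega> ` keys F) \<le> \<omega> m"
  by simp

lemma keys_diff_low_part: "m \<in> keys (F - low_part \<omega> F) \<Longrightarrow> Min (\<omega> ` keys F) < \<omega> m"
  for F :: "'a \<Rightarrow>\<^sub>0 'b::ab_group_add"
proof -
  assume "m \<in> keys (F - low_part \<omega> F)"
  then have "m \<in> keys F" "\<omega> m \<noteq> Min (\<omega> ` keys F)"
    by (auto simp: in_keys_iff lookup_minus low_part_def lookup_restr split: if_splits)
  then show ?thesis using low_part_le[of m F \<omega>] by linarith
qed

lemma keys_diff_subset: "keys (F - G) \<subseteq> keys F \<union> keys G"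
  for F :: "'a \<Rightarrow>\<^sub>0 'b::ab_group_add"
  by (auto simp: in_keys_iff lookup_minus)

text \<open>If the lowest components are coprime, their only syzygies are the Koszul ones, and subtracting
  the corresponding multiple of \<open>f g - g f = 0\<close> raises the order of a representation.\<close>

lemma hom_in_ideal2_low_part:
  fixes f g h :: "'k::field mpoly4" and \<omega> :: "expo \<Rightarrow> nat"
  assumes add: "additive \<omega>" and nz: "f \<noteq> 0" "g \<noteq> 0"
    and coprime: "\<And>r. r dvd low_part \<omega> f \<Longrightarrow> r dvd low_part \<omega> g \<Longrightarrow> r dvd 1"
    and h: "hom_wt \<omega> k h" "h \<in> ideal2 f g"
  shows "h \<in> ideal2 (low_part \<omega> f) (low_part \<omega> g)"
proof -
  define f0 g0 where "f0 = low_part \<omega> f" and "g0 = low_part \<omega> g"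
  define p q where "p = Min (\<omega> ` keys f)" and "q = Min (\<omega> ` keys g)"
  have f0g0: "f0 \<noteq> 0" "g0 \<noteq> 0" using nz by (auto simp: f0_def g0_def low_part_nonzero)
  have restr_low: "restr (\<lambda>m. \<omega> m = v) (a * F) = restr (\<lambda>m. \<omega> m + Min (\<omega> ` keys F) = v) a * low_part \<omega> F"
    if "\<And>m. m \<in> keys a \<Longrightarrow> v \<le> \<omega> m + Min (\<omega> ` keys F)" for a F :: "'k mpoly4" and v
    unfolding low_part_def
  proof (rule restr_mult)
    fix m n assume "m \<in> keys a" "n \<in> keys F"
    then show "\<omega> (m + n) = v \<longleftrightarrow> \<omega> m + Min (\<omega> ` keys F) = v \<and> \<omega> n = Min (\<omega> ` keys F)"
      using that[of m] low_part_le[of n F \<omega>] add unfolding additive_def by (metis add_left_cancel add_le_cancel_left le_antisym)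
  qed
  \<comment> \<open>\<open>v\<close> bounds the weights in \<open>a * f\<close> and
    \<open>b * g\<close> from below; the induction raises it up to the weight \<open>k\<close> of
    \<open>h\<close>.\<close>
  have main: "h \<in> ideal2 f0 g0"
    if "h = a * f + b * g" "\<And>m. m \<in> keys a \<Longrightarrow> v \<le> \<omega> m + p" "\<And>m. m \<in> keys b \<Longrightarrow> v \<le> \<omega> m + q" "v \<le> k"
    for a b v
    using that
  proof (induction "k - v" arbitrary: a b v rule: less_induct)
    case less
    let ?a = "restr (\<lambda>m. \<omega> m + p = v) a" and ?b = "restr (\<lambda>m. \<omega> m + q = v) b"
    \<comment> \<open>In weight \<open>v\<close> only the lowest parts contribute. The left-hand
      side is \<open>h\<close> itself for \<open>v = k\<close> and zero before, which gives a
      syzygy.\<close>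
    have low: "restr (\<lambda>m. \<omega> m = v) h = ?a * f0 + ?b * g0"
      unfolding less.prems(1) restr_add f0_def g0_def p_def q_def
      by (subst (1 2) restr_low) (use less.prems(2,3) in \<open>auto simp: p_def q_def\<close>)
    show ?case
    proof (cases "v = k")
      case True
      then have "restr (\<lambda>m. \<omega> m = v) h = h" using h(1) by (intro restr_id) (simp add: hom_wt_def)
      from trans[OF this[symmetric] low] show ?thesis by (rule ideal2I)
    next
      case False
      have "restr (\<lambda>m. \<omega> m = v) h = 0"
        using h(1) False by (intro restr_eq_0) (auto simp: hom_wt_def)
      then have syz: "?a * f0 + ?b * g0 = 0" using low by simp
      have "?a * f0 = g0 * (- ?b)" using syz by (simp add: eq_neg_iff_add_eq_0 mult.commute)
      then have dvd: "g0 dvd ?a * f0" by simp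
      have "g0 dvd ?a"
        by (rule mpoly4_coprime_dvd_mult[OF _ dvd f0g0(2)]) (rule coprime[folded f0_def g0_def])
      then obtain c where c: "?a = g0 * c" by (elim dvdE)
      have "(c * f0 + ?b) * g0 = 0" using syz unfolding c by (simp add: algebra_simps)
      then have b: "?b = - (c * f0)" using f0g0 by (simp add: eq_neg_iff_add_eq_0 add.commute)
      \<comment> \<open>The cofactor \<open>c\<close> has weight \<open>v - p - q\<close>, stated
        without subtraction.\<close>
      have keys_c: "\<omega> m + p + q = v" if m: "m \<in> keys c" for m
      proof -
        have "c \<noteq> 0" using m by auto
        have hom: "hom_wt \<omega> (v - p) (g0 * c)" unfolding c[symmetric] by (auto simp: hom_wt_def)
        obtain i j where ij: "hom_wt \<omega> i g0" "hom_wt \<omega> j c" "i + j = v - p"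
          by (rule hom_wt_factor[OF add hom f0g0(2) \<open>c \<noteq> 0\<close>])
        have "g0 * c \<noteq> 0" using f0g0 \<open>c \<noteq> 0\<close> by simp
        then obtain m' where "m' \<in> keys ?a" unfolding c[symmetric] by (metis keys_eq_empty ex_in_conv)
        then have "v \<ge> p" by simp
        moreover have "i = q"
        proof -
          obtain m' where "m' \<in> keys g0" using f0g0(2) by (metis keys_eq_empty ex_in_conv)
          then show ?thesis using ij(1) by (auto simp: hom_wt_def g0_def low_part_def q_def)
        qed
        ultimately show ?thesis using ij m by (auto simp: hom_wt_def)
      qed
      define Ra Rb where "Ra = restr (\<lambda>m. \<not> \<omega> m + p = v) a" and "Rb = restr (\<lambda>m. \<not> \<omega> m + q = v) b"
      have aR: "a = g0 * c + Ra" unfolding Ra_def c[symmetric] by (rule restr_split)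
      have bR: "b = - (c * f0) + Rb" unfolding Rb_def b[symmetric] by (rule restr_split)
      \<comment> \<open>The lowest part \<open>g0 * c\<close> of \<open>a\<close> cancels, so the
        new representation has order greater than \<open>v\<close>.\<close>
      have a': "a - c * g = Ra - c * (g - g0)" unfolding right_diff_distrib by (simp add: aR mult.commute[of g0])
      have b': "b + c * f = Rb - (- c) * (f - f0)" unfolding right_diff_distrib by (simp add: bR)
      have ka: "Suc v \<le> \<omega> m + p" if "m \<in> keys (a - c * g)" for m
      proof -
        have "m \<in> keys Ra \<or> m \<in> keys (c * (g - g0))"
          using subsetD[OF keys_diff_subset that[unfolded a']] by (rule UnE) simp_all
        then show ?thesis
        proof
          assume "m \<in> keys Ra"
          then show ?thesis using less.prems(2)[of m] by (auto simp: Ra_def)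
        next
          assume "m \<in> keys (c * (g - g0))"
          then obtain m1 m2 where "m1 \<in> keys c" "m2 \<in> keys (g - g0)" "m = m1 + m2" by (rule keys_multE)
          then show ?thesis using keys_c[of m1] keys_diff_low_part[of m2 g \<omega>] add
            by (auto simp: additive_def g0_def q_def)
        qed
      qed
      have kb: "Suc v \<le> \<omega> m + q" if "m \<in> keys (b + c * f)" for m
      proof -
        have "m \<in> keys Rb \<or> m \<in> keys ((- c) * (f - f0))"
          using subsetD[OF keys_diff_subset that[unfolded b']] by (rule UnE) simp_all
        then show ?thesis
        proof
          assume "m \<in> keys Rb"
          then show ?thesis using less.prems(3)[of m] by (auto simp: Rb_def)
        next
          assume "m \<in> keys ((- c) * (f - f0))"
          then obtain m1 m2 where "m1 \<in> keys (- c)" "m2 \<in> keys (f - f0)" "m = m1 + m2" by (rule keys_multE)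
          then show ?thesis using keys_c[of m1] keys_diff_low_part[of m2 f \<omega>] add
            by (auto simp: additive_def f0_def p_def)
        qed
      qed
      show ?thesis
      proof (rule less.hyps)
        show "k - Suc v < k - v" "Suc v \<le> k" using False less.prems(4) by auto
        show "h = (a - c * g) * f + (b + c * f) * g"
          using less.prems(1) by (simp add: algebra_simps)
      qed (use ka kb in auto)
    qed
  qed
  obtain a b where "h = a * f + b * g" by (rule ideal2E[OF h(2)])
  then have "h \<in> ideal2 f0 g0" by (intro main[of a b 0]) auto
  then show ?thesis by (simp add: f0_def g0_def)
qed

lemma hom_wt_power: "additive \<omega> \<Longrightarrow> hom_wt \<omega> i F \<Longrightarrow> \<exists>j. hom_wt \<omega> j (F ^ n)"
  for F :: "'k::comm_ring_1 mpoly4" and \<omega> :: "expo \<Rightarrow> 'w::plus"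
proof (induction n)
  case 0
  show ?case by (rule exI[of _ "\<omega> 0"]) (simp add: hom_wt_def)
next
  case (Suc n)
  then obtain j where "hom_wt \<omega> j (F ^ n)" by blast
  then have "hom_wt \<omega> (i + j) (F ^ Suc n)"
    unfolding power_Suc by (rule hom_wt_mult[OF Suc.prems])
  then show ?case by blast
qed

lemma eval4_0_if_radical:
  fixes f g :: "'k::idom mpoly4"
  assumes "h ^ n \<in> ideal2 f g" "eval4 f a b c e = 0" "eval4 g a b c e = 0" "n > 0"
  shows "eval4 h a b c e = 0"
proof -
  obtain A B where "h ^ n = A * f + B * g" by (rule ideal2E[OF assms(1)])
  then have "eval4 (h ^ n) a b c e = 0"
    using assms(2,3) by (simp add: eval4.ev_add eval4.ev_mult)
  then have "eval4 h a b c e ^ n = 0" by (simp add: eval4.ev_power)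
  then show ?thesis by simp
qed

text \<open>A difference of two monomials of equal bidegree lies in the ideal of the curve and is
  homogeneous for \<open>\<omega>\<close>, so a power of it moves from \<open>(f, g)\<close> to the
  ideal of the lowest parts. Their common zeros thus satisfy the equations of the curve, which
  \<open>no_bihom_pair\<close> excludes.\<close>

lemma low_parts_not_coprime:
  fixes f g :: "'k::field_char_0 mpoly4" and \<omega> :: "expo \<Rightarrow> nat"
  assumes closed: "alg_closed_field TYPE('k)"
    and add: "additive \<omega>" and \<omega>: "\<And>m n. bideg m = bideg n \<Longrightarrow> \<omega> m = \<omega> n"
    and nz: "f \<noteq> 0" "g \<noteq> 0"
    and rad: "radical (ideal2 f g) = macaulay_ideal"
    and f0: "hom_wt bideg v (low_part \<omega> f)" "low_part \<omega> f \<in> macaulay_ideal"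
    and g0: "hom_wt bideg v' (low_part \<omega> g)" "low_part \<omega> g \<in> macaulay_ideal"
    and coprime: "\<And>r. r dvd low_part \<omega> f \<Longrightarrow> r dvd low_part \<omega> g \<Longrightarrow> r dvd 1"
  shows False
proof -
  let ?f = "low_part \<omega> f" and ?g = "low_part \<omega> g"
  have bin: "eval4 (single m 1 - single n 1) a b c e = 0"
    if mn: "bideg m = bideg n" and 0: "eval4 ?f a b c e = 0" "eval4 ?g a b c e = 0" for m n a b c e
  proof -
    let ?h = "single m 1 - single n 1 :: 'k mpoly4"
    have h: "hom_wt bideg (bideg m) ?h"
      using mn by (intro hom_wt_diff hom_wt_single) auto
    have "eval4 ?h 1 1 1 1 = 0" by (simp add: eval4.ev_diff mon_eval_def)
    then have "?h \<in> radical (ideal2 f g)"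
      unfolding rad using bihom_in_macaulay_ideal_iff[OF h] by simp
    then obtain N where "?h ^ N \<in> ideal2 f g" by (auto simp: radical_def)
    then obtain A B where AB: "?h ^ N = A * f + B * g" by (rule ideal2E)
    \<comment> \<open>One more factor makes the exponent positive, since \<open>radical\<close>
      admits the exponent \<open>0\<close>.\<close>
    have "?h ^ Suc N = (?h * A) * f + (?h * B) * g"
      by (simp only: power_Suc AB distrib_left mult.assoc)
    then have N: "?h ^ Suc N \<in> ideal2 f g" by (rule ideal2I)
    have "hom_wt \<omega> (\<omega> m) ?h" 
      by (intro hom_wt_diff hom_wt_single refl \<omega> mn[symmetric])
    then obtain k where k: "hom_wt \<omega> k (?h ^ Suc N)" using hom_wt_power[OF add] by blast
    have "?h ^ Suc N \<in> ideal2 ?f ?g"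
      by (rule hom_in_ideal2_low_part[OF add nz _ k N]) (rule coprime)
    then show ?thesis by (rule eval4_0_if_radical) (use 0 in auto)
  qed
  show False
  proof (rule no_bihom_pair[OF closed f0(1) hom_wt_bideg_tdeg[OF f0(1)] _ g0(1) hom_wt_bideg_tdeg[OF g0(1)]])
    show "eval4 ?f 1 1 1 1 = 0" "eval4 ?g 1 1 1 1 = 0"
      using f0 g0 bihom_in_macaulay_ideal_iff by blast+
    fix a b c e assume 0: "eval4 ?f a b c e = 0" "eval4 ?g a b c e = 0"
    \<comment> \<open>The binomials are \<open>w z - x y\<close>, \<open>x ^ 3 - w ^ 2 y\<close> and
      \<open>y ^ 3 - x z ^ 2\<close>.\<close>
    show "a * e = b * c \<and> b ^ 3 = a ^ 2 * c \<and> c ^ 3 = b * e ^ 2"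
      using bin[of "expo4 1 0 0 1" "expo4 0 1 1 0", OF _ 0] bin[of "expo4 0 3 0 0" "expo4 2 0 1 0", OF _ 0]
        bin[of "expo4 0 0 3 0" "expo4 0 1 0 2", OF _ 0]
      by (simp add: bideg_def eval4.ev_diff mon_eval_def)
  qed
qed

subsection \<open>Counting dimensions of graded pieces\<close>

context Vector_Spaces.vector_space
begin

lemma independent_Un_imp_span_Int:
  assumes "independent (A \<union> B)" "A \<inter> B = {}" "finite A" "finite B" "x \<in> span A" "x \<in> span B"
  shows "x = 0"
proof -
  obtain u where u: "x = (\<Sum>v\<in>A. scale (u v) v)" using assms by (auto simp: span_finite)
  obtain w where w: "x = (\<Sum>v\<in>B. scale (w v) v)" using assms by (auto simp: span_finite)
  let ?U = "\<lambda>v. if v \<in> A then u v else - w v"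
  have "(\<Sum>v\<in>A \<union> B. scale (?U v) v) = (\<Sum>v\<in>A. scale (?U v) v) + (\<Sum>v\<in>B. scale (?U v) v)"
    using assms by (intro sum.union_disjoint) auto
  also have "(\<Sum>v\<in>A. scale (?U v) v) = x" unfolding u by (rule sum.cong) auto
  also have "(\<Sum>v\<in>B. scale (?U v) v) = - x"
    unfolding w sum_negf[symmetric] by (rule sum.cong) (use assms(2) in auto)
  finally have "(\<Sum>v\<in>A \<union> B. scale (?U v) v) = 0" by simp
  note * = independentD[OF assms(1) finite_UnI[OF assms(3,4)] order.refl this]
  have "u v = 0" if "v \<in> A" for v using *[of v] that by simp
  then show ?thesis by (simp add: u)
qed

lemma independent_UnI:
  assumes "independent A" "independent B" "A \<inter> B = {}" "finite A" "finite B"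
    and "\<And>x. x \<in> span A \<Longrightarrow> x \<in> span B \<Longrightarrow> x = 0"
  shows "independent (A \<union> B)"
proof
  assume "dependent (A \<union> B)"
  then obtain u where u: "\<exists>v\<in>A \<union> B. u v \<noteq> 0" "(\<Sum>v\<in>A \<union> B. scale (u v) v) = 0"
    using assms dependent_finite[of "A \<union> B"] by auto
  let ?a = "\<Sum>v\<in>A. scale (u v) v" and ?b = "\<Sum>v\<in>B. scale (u v) v"
  have ab: "?a = - ?b"
    using u(2) assms by (simp add: sum.union_disjoint eq_neg_iff_add_eq_0)
  have "?a \<in> span A" "?b \<in> span B" by (intro span_sum span_scale span_base, assumption)+
  then have "?a = 0" using assms(6)[of ?a] ab span_neg by metis
  then have "?a = 0" "?b = 0" using ab by simp_all
  then have "u v = 0" if "v \<in> A \<union> B" for v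
    using that independentD[OF assms(1,4) order.refl \<open>?a = 0\<close>, of v]
      independentD[OF assms(2,5) order.refl \<open>?b = 0\<close>, of v] by blast
  then show False using u(1) by blast
qed

end

section \<open>Forms of fixed degree as vector spaces\<close>

abbreviation mscale :: "'k::field \<Rightarrow> 'k mpoly4 \<Rightarrow> 'k mpoly4" where
  "mscale c F \<equiv> single 0 c * F"

interpretation mp: Vector_Spaces.vector_space "mscale :: 'k::field \<Rightarrow> _"
  by unfold_locales (auto simp: algebra_simps single_add mult_single simp flip: mult.assoc)

interpretation mpp: vector_space_pair "mscale :: 'k::field \<Rightarrow> _" "mscale :: 'k::field \<Rightarrow> _" ..

definition monomials :: "expo set \<Rightarrow> 'k::field mpoly4 set" where
  "monomials A = (\<lambda>m. single m 1) ` A"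

definition Mon :: "nat \<Rightarrow> 'k::field mpoly4 set" where
  "Mon n = monomials {m. tdeg m = n}"

lemma inj_single_1: "inj_on (\<lambda>m. single m (1::'k::field)) A"
  by (auto intro!: inj_onI) (metis lookup_single_eq lookup_single_not_eq zero_neq_one)

lemma span_monomials: "F \<in> mp.span (monomials A) \<longleftrightarrow> keys F \<subseteq> A"
proof
  assume "F \<in> mp.span (monomials A)"
  then show "keys F \<subseteq> A"
  proof (induction rule: mp.span_induct_alt)
    case base
    then show ?case by simp
  next
    case (step c x y)
    then obtain m where "m \<in> A" "x = single m 1" by (auto simp: monomials_def)
    then have "keys (mscale c x) \<subseteq> A" by (auto simp: mult_single)
    then show ?case using step keys_add[of "mscale c x" y] by blast
  qed
next
  assume A: "keys F \<subseteq> A"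
  have "(\<Sum>m\<in>keys F. single m (lookup F m)) \<in> mp.span (monomials A)"
  proof (rule mp.span_sum)
    fix m assume "m \<in> keys F"
    then have "mscale (lookup F m) (single m 1) \<in> mp.span (monomials A)"
      using A by (intro mp.span_scale mp.span_base) (auto simp: monomials_def)
    then show "single m (lookup F m) \<in> mp.span (monomials A)" by (simp add: mult_single)
  qed
  then show "F \<in> mp.span (monomials A)" using poly_mapping_eq_sum_single[of F] by simp
qed

lemma independent_monomials: "mp.independent (monomials A :: 'k::field mpoly4 set)"
proof -
  have "a \<notin> mp.span (monomials A - {a})" if a: "a \<in> monomials A" for a :: "'k mpoly4"
  proof -
    obtain m where m: "m \<in> A" "a = single m 1" using a by (auto simp: monomials_def)
    have "monomials A - {a} \<subseteq> monomials (A - {m})" by (auto simp: monomials_def m)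
    then have "mp.span (monomials A - {a}) \<subseteq> mp.span (monomials (A - {m}))" by (rule mp.span_mono)
    moreover have "a \<notin> mp.span (monomials (A - {m}))" by (simp add: span_monomials m)
    ultimately show ?thesis by blast
  qed
  then show ?thesis by (auto simp: mp.dependent_def)
qed

lemma span_Mon: "F \<in> mp.span (Mon n) \<longleftrightarrow> homogeneous F n"
  by (auto simp: Mon_def span_monomials homogeneous_def)

text \<open>Restriction maps a monomial to itself or to zero. This is why complements are chosen
  among the monomials.\<close>

lemma restr_in_span:
  assumes "S \<subseteq> monomials A" "F \<in> mp.span S"
  shows "restr P F \<in> mp.span S"
  using assms(2)
proof (induction rule: mp.span_induct_alt)
  case base
  then show ?case by (subst restr_eq_0) (auto simp: mp.span_zero)
next
  case (step c x y)
  obtain m where "x = single m 1" using step assms(1) by (auto simp: monomials_def)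
  then have "restr P (mscale c x) = (if P m then mscale c x else 0)"
    by (auto intro!: restr_id restr_eq_0 simp: mult_single split: if_splits)
  then have "restr P (mscale c x) \<in> mp.span S"
    using step by (simp add: mp.span_zero mp.span_scale mp.span_base)
  then show ?case using step by (simp add: restr_add mp.span_add)
qed

text \<open>The dimension of the space of forms of degree \<open>n\<close> in four
  variables.\<close>

definition hdim :: "nat \<Rightarrow> nat" where "hdim n = (n + 3) choose n"

lemma hdim_eq: "6 * int (hdim n) = (int n + 1) * (int n + 2) * (int n + 3)"
proof (induction n)
  case 0
  show ?case by (simp add: hdim_def)
next
  case (Suc n)
  have "(Suc n) * ((Suc n + 3) choose (Suc n)) = (Suc n + 3) * ((n + 3) choose n)"
    using Suc_times_binomial_eq[of "n + 3" n] by simp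
  then have "int (Suc n * hdim (Suc n)) = int ((n + 4) * hdim n)"
    unfolding hdim_def by (simp only: add_Suc) (simp add: eval_nat_numeral)
  then have "int (Suc n) * int (hdim (Suc n)) = (int n + 4) * int (hdim n)"
    by (simp only: of_nat_mult of_nat_add of_nat_numeral)
  then have "6 * (int (Suc n) * int (hdim (Suc n))) = 6 * ((int n + 4) * int (hdim n))"
    by (rule arg_cong)
  then have "int (Suc n) * (6 * int (hdim (Suc n))) = (int n + 4) * (6 * int (hdim n))"
    by (simp only: mult.left_commute)
  then have "int (Suc n) * (6 * int (hdim (Suc n))) = int (Suc n) * ((int n + 2) * (int n + 3) * (int n + 4))"
    unfolding Suc by (simp add: algebra_simps)
  then have "6 * int (hdim (Suc n)) = (int n + 2) * (int n + 3) * (int n + 4)"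
    by (subst (asm) mult_cancel_left) simp
  then show ?case by (simp add: algebra_simps)
qed

lemma card_Mon: "finite (Mon n :: 'k::field mpoly4 set)" "card (Mon n :: 'k mpoly4 set) = hdim n"
proof -
  let ?L = "{l :: nat list. length l = 4 \<and> sum_list l = n}"
  let ?h = "\<lambda>m. [lookup m W, lookup m X, lookup m Y, lookup m Z]"
  have bij: "bij_betw ?h {m. tdeg m = n} ?L"
  proof (rule bij_betw_imageI)
    show "inj_on ?h {m. tdeg m = n}" by (auto intro!: inj_onI expo_eqI)
    show "?h ` {m. tdeg m = n} = ?L"
    proof (intro equalityI subsetI)
      fix l assume "l \<in> ?L"
      then obtain a b c e where "l = [a, b, c, e]" "a + b + c + e = n"
        by (auto simp: length_Suc_conv numeral_eq_Suc)
      then show "l \<in> ?h ` {m. tdeg m = n}"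
        by (intro image_eqI[of _ _ "expo4 a b c e"]) (auto simp: tdeg_def)
    qed (auto simp: tdeg_def)
  qed
  have card: "card ?L = (n + 3) choose n" using card_length_sum_list[of 4 n] by (simp add: add.commute)
  then have "card {m. tdeg m = n} = hdim n" using bij_betw_same_card[OF bij] by (simp add: hdim_def)
  moreover have "hdim n > 0" by (simp add: hdim_def)
  ultimately have fin: "finite {m. tdeg m = n}" and "card {m. tdeg m = n} = hdim n"
    by (auto intro: card_ge_0_finite)
  then show "finite (Mon n :: 'k mpoly4 set)" "card (Mon n :: 'k mpoly4 set) = hdim n"
    by (auto simp: Mon_def monomials_def card_image[OF inj_single_1])
qed

text \<open>Extending \<open>B\<close> to a basis inside \<open>B \<union> Mon n\<close> adds only
  monomials.\<close>

lemma ex_monomial_complement: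
  fixes B :: "'k::field mpoly4 set"
  assumes "mp.independent B" "B \<subseteq> mp.span (Mon n)"
  obtains A where "A \<subseteq> Mon n" "A \<inter> B = {}" "mp.independent (B \<union> A)" "Mon n \<subseteq> mp.span (B \<union> A)"
    "card A + card B = hdim n" "finite A" "finite B"
proof -
  obtain C where C: "B \<subseteq> C" "C \<subseteq> B \<union> Mon n" "mp.independent C" "B \<union> Mon n \<subseteq> mp.span C"
    using mp.maximal_independent_subset_extend[of B "B \<union> Mon n"] assms(1) by blast
  have "C \<subseteq> mp.span (Mon n)" using C(2) assms(2) by (auto intro: mp.span_base)
  then have C1: "finite C" "card C \<le> hdim n"
    using mp.independent_span_bound[OF card_Mon(1)[of n] C(3)] card_Mon(2)[of n, where 'k = 'k] by auto
  have "card (Mon n :: 'k mpoly4 set) \<le> card C"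
    using mp.independent_span_bound[OF C1(1), of "Mon n"] independent_monomials C(4) by (auto simp: Mon_def)
  then have "card C = hdim n" using C1 card_Mon(2)[of n, where 'k = 'k] by simp
  moreover have fB: "finite B" using C(1) C1(1) by (rule finite_subset)
  ultimately have "card (C - B) + card B = hdim n"
    using C(1) card_mono[OF C1(1) C(1)] by (simp add: card_Diff_subset)
  moreover have "B \<union> (C - B) = C" using C(1) by blast
  ultimately show ?thesis using that[of "C - B"] C C1 fB by auto
qed

lemma linear_mult: "Vector_Spaces.linear mscale mscale (\<lambda>F. G * F)"
  by unfold_locales (auto simp: algebra_simps)

lemma mult_span_image: "F \<in> mp.span S \<Longrightarrow> G * F \<in> mp.span ((\<lambda>F. G * F) ` S)"
  using mpp.linear_span_image[OF linear_mult[of G], of S] by blast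

lemma independent_mult_image:
  fixes G :: "'k::field mpoly4"
  assumes "mp.independent S" "G \<noteq> 0"
  shows "mp.independent ((\<lambda>F. G * F) ` S)" "card ((\<lambda>F. G * F) ` S) = card S"
proof -
  have inj: "inj_on (\<lambda>F. G * F) T" for T using assms(2) by (auto intro!: inj_onI)
  show "mp.independent ((\<lambda>F. G * F) ` S)" "card ((\<lambda>F. G * F) ` S) = card S"
    by (intro mpp.linear_independent_injective_image[OF linear_mult assms(1)] card_image inj)+
qed

lemma homogeneous_mult: "homogeneous F i \<Longrightarrow> homogeneous G j \<Longrightarrow> homogeneous (F * G) (i + j)"
  by (simp add: homogeneous_iff_hom_wt hom_wt_mult[OF additive_tdeg])

lemma mult_Mon_subset: "homogeneous g d \<Longrightarrow> (\<lambda>F. g * F) ` Mon n \<subseteq> mp.span (Mon (n + d))"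
proof
  fix F assume "homogeneous g d" "F \<in> (\<lambda>F. g * F) ` Mon n"
  then obtain G where G: "F = G * g" "G \<in> Mon n" by (auto simp: mult.commute)
  moreover have "homogeneous G n" using mp.span_base[OF G(2)] by (simp add: span_Mon)
  ultimately have "F = G * g" "homogeneous G n" by blast+
  then show "F \<in> mp.span (Mon (n + d))"
    using homogeneous_mult[OF _ \<open>homogeneous g d\<close>] by (simp add: span_Mon)
qed

text \<open>The Koszul relation bounds the dimension of \<open>(f, g)\<close> in degree \<open>n + d1 + d2\<close> from above.\<close>

lemma ideal2_dim_upper:
  fixes f g :: "'k::field mpoly4"
  assumes f: "homogeneous f d1" and g: "homogeneous g d2" "g \<noteq> 0"
  obtains G where "finite G" "card G + hdim n \<le> hdim (n + d2) + hdim (n + d1)"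
    "\<And>a b. homogeneous a (n + d2) \<Longrightarrow> homogeneous b (n + d1) \<Longrightarrow> a * f + b * g \<in> mp.span G"
proof -
  let ?B = "(\<lambda>F. g * F) ` Mon n"
  have B: "mp.independent ?B" "card ?B = hdim n" "?B \<subseteq> mp.span (Mon (n + d2))"
    using independent_mult_image[OF independent_monomials g(2)] card_Mon(2)[of n, where 'k = 'k] mult_Mon_subset[OF g(1)]
    by (auto simp: Mon_def)
  \<comment> \<open>\<open>f\<close> times a multiple of \<open>g\<close> is again a multiple of
    \<open>g\<close>, so among the cofactors of \<open>f\<close> only a complement \<open>A\<close>
    of the multiples of \<open>g\<close> matters.\<close>
  obtain A where A: "A \<subseteq> Mon (n + d2)" "Mon (n + d2) \<subseteq> mp.span (?B \<union> A)"
    "card A + hdim n = hdim (n + d2)" "finite A"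
    using ex_monomial_complement[OF B(1,3)] B(2) by metis
  let ?G = "(\<lambda>F. f * F) ` A \<union> (\<lambda>F. g * F) ` Mon (n + d1)"
  have gspan: "g * F \<in> mp.span ?G" if "homogeneous F (n + d1)" for F
  proof -
    have "g * F \<in> mp.span ((\<lambda>F. g * F) ` Mon (n + d1))"
      using that by (intro mult_span_image) (simp add: span_Mon)
    then show ?thesis using mp.span_mono[of "(\<lambda>F. g * F) ` Mon (n + d1)" ?G] by blast
  qed
  show ?thesis
  proof (rule that[of ?G])
    show "finite ?G" using A(4) by (simp add: card_Mon(1))
    have "card ?G \<le> card ((\<lambda>F. f * F) ` A) + card ((\<lambda>F. g * F) ` (Mon (n + d1) :: 'k mpoly4 set))"
      by (rule card_Un_le)
    also have "\<dots> \<le> card A + hdim (n + d1)"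
      using card_image_le[OF A(4), of "\<lambda>F. f * F"]
        card_image_le[OF card_Mon(1)[of "n + d1", where 'k = 'k], of "\<lambda>F. g * F"]
      by (simp add: card_Mon(2))
    finally show "card ?G + hdim n \<le> hdim (n + d2) + hdim (n + d1)" using A(3) by simp
    fix a b :: "'k mpoly4" assume a: "homogeneous a (n + d2)" and b: "homogeneous b (n + d1)"
    have "a \<in> mp.span (?B \<union> A)"
      using a A(2) mp.span_mono[OF A(2)] unfolding span_Mon[symmetric] mp.span_span by blast
    then obtain x y where xy: "a = x + y" "x \<in> mp.span ?B" "y \<in> mp.span A"
      unfolding mp.span_Un by blast
    then obtain c where c: "x = g * c" "c \<in> mp.span (Mon n)"
      using mpp.linear_span_image[OF linear_mult[of g], of "Mon n"] by blast
    have "f * y \<in> mp.span ?G"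
      using mult_span_image[OF xy(3), of f] mp.span_mono[of "(\<lambda>F. f * F) ` A" ?G] by blast
    moreover have "g * (c * f) \<in> mp.span ?G"
      using c(2) f by (intro gspan homogeneous_mult) (simp_all add: span_Mon)
    moreover have "g * b \<in> mp.span ?G" using b by (rule gspan)
    ultimately have "f * y + (g * (c * f) + g * b) \<in> mp.span ?G" by (intro mp.span_add)
    then show "a * f + b * g \<in> mp.span ?G" by (simp add: xy c algebra_simps)
  qed
qed

text \<open>For coprime \<open>f\<close> and \<open>g\<close> there are no other relations, so the bound is attained.\<close>

lemma ideal2_dim_lower:
  fixes f g :: "'k::field mpoly4"
  assumes f: "homogeneous f d1" "f \<noteq> 0" and g: "homogeneous g d2" "g \<noteq> 0"
    and coprime: "\<And>r. r dvd f \<Longrightarrow> r dvd g \<Longrightarrow> r dvd 1"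
  obtains K where "mp.independent K" "card K + hdim n = hdim (n + d2) + hdim (n + d1)"
    "\<And>F. F \<in> mp.span K \<Longrightarrow> \<exists>a b. F = a * f + b * g \<and> homogeneous a (n + d2) \<and> homogeneous b (n + d1)"
proof -
  let ?B = "(\<lambda>F. g * F) ` Mon n"
  have B: "mp.independent ?B" "card ?B = hdim n" "?B \<subseteq> mp.span (Mon (n + d2))"
    using independent_mult_image[OF independent_monomials g(2)] card_Mon(2)[of n, where 'k = 'k] mult_Mon_subset[OF g(1)]
    by (auto simp: Mon_def)
  obtain A where A: "A \<subseteq> Mon (n + d2)" "A \<inter> ?B = {}" "mp.independent (?B \<union> A)"
    "card A + hdim n = hdim (n + d2)" "finite A"
    using ex_monomial_complement[OF B(1,3)] B(2) by metis
  have indA: "mp.independent A" using A(3) mp.independent_mono by blast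
  let ?P = "(\<lambda>F. f * F) ` A" and ?Q = "(\<lambda>F. g * F) ` Mon (n + d1)"
  have P: "mp.independent ?P" "card ?P = card A" using independent_mult_image[OF indA f(2)] by auto
  have Q: "mp.independent ?Q" "card ?Q = hdim (n + d1)"
    using independent_mult_image[OF independent_monomials g(2)] card_Mon(2)[of "n + d1", where 'k = 'k]
    by (auto simp: Mon_def)
  have AB: "x = 0" if "x \<in> mp.span A" "x \<in> mp.span ?B" for x
    using mp.independent_Un_imp_span_Int[of A ?B x] A that by (auto simp: Un_commute card_Mon(1))
  \<comment> \<open>From \<open>f * y = g * z\<close> and coprimality, \<open>g\<close> divides
    \<open>y\<close>, so \<open>y\<close> lies both in the complement and in the multiples of
    \<open>g\<close>.\<close>
  have inter: "F = 0" if F: "F \<in> mp.span ?P" "F \<in> mp.span ?Q" for F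
  proof -
    obtain y where y: "F = f * y" "y \<in> mp.span A"
      using F(1) mpp.linear_span_image[OF linear_mult[of f], of A] by blast
    obtain z where z: "F = g * z" using F(2) mpp.linear_span_image[OF linear_mult[of g], of "Mon (n + d1)"] by blast
    have dvd: "g dvd y * f" using y(1) z by (metis dvd_triv_left mult.commute)
    have "g dvd y" by (rule mpoly4_coprime_dvd_mult[OF _ dvd g(2)]) (rule coprime)
    then obtain c where c: "y = g * c" by (elim dvdE)
    have "homogeneous y (n + d2)"
      using y(2) mp.span_mono[OF A(1)] by (auto simp flip: span_Mon)
    then have "hom_wt tdeg (n + d2) y" by (simp add: homogeneous_iff_hom_wt)
    \<comment> \<open>The cofactor \<open>c\<close> is not known to be homogeneous, so its part of
      degree \<open>n\<close> takes its place.\<close>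
    then have "restr (\<lambda>m. tdeg m = n + d2) y = y" by (intro restr_id) (simp add: hom_wt_def)
    moreover have "restr (\<lambda>m. tdeg m = n + d2) (c * g) = restr (\<lambda>m. tdeg m = n) c * g"
      using g(1) by (intro restr_mult_hom[OF additive_tdeg]) (simp add: homogeneous_iff_hom_wt)
    ultimately have "y = g * restr (\<lambda>m. tdeg m = n) c" by (simp only: c mult.commute)
    moreover have "restr (\<lambda>m. tdeg m = n) c \<in> mp.span (Mon n)"
      by (auto simp: span_Mon homogeneous_def)
    ultimately have "y \<in> mp.span ?B" using mult_span_image by metis
    then have "y = 0" using AB y(2) by simp
    then show ?thesis using y by simp
  qed
  have disj: "?P \<inter> ?Q = {}"
  proof -
    have "0 \<notin> ?P" using P(1) mp.dependent_zero[of ?P] by metis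
    moreover have "x = 0" if "x \<in> ?P" "x \<in> ?Q" for x
      by (rule inter) (rule mp.span_base, rule that)+
    ultimately show ?thesis by (metis disjoint_iff)
  qed
  show ?thesis
  proof (rule that[of "?P \<union> ?Q"])
    show "mp.independent (?P \<union> ?Q)"
      using P(1) Q(1) disj A(5) inter by (intro mp.independent_UnI) (auto simp: card_Mon(1))
    show "card (?P \<union> ?Q) + hdim n = hdim (n + d2) + hdim (n + d1)"
      using A P(2) Q(2) by (subst card_Un_disjoint[OF _ _ disj]) (auto simp: card_Mon(1))
    fix F assume "F \<in> mp.span (?P \<union> ?Q)"
    then obtain x y where xy: "F = x + y" "x \<in> mp.span ?P" "y \<in> mp.span ?Q"
      unfolding mp.span_Un by blast
    obtain a where a: "x = f * a" "a \<in> mp.span A"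
      using xy(2) mpp.linear_span_image[OF linear_mult[of f], of A] by blast
    obtain b where b: "y = g * b" "b \<in> mp.span (Mon (n + d1))"
      using xy(3) mpp.linear_span_image[OF linear_mult[of g], of "Mon (n + d1)"] by blast
    have "homogeneous a (n + d2)" using a(2) mp.span_mono[OF A(1)] by (auto simp flip: span_Mon)
    moreover have "homogeneous b (n + d1)" using b(2) by (simp add: span_Mon)
    moreover have "F = a * f + b * g" unfolding xy(1) a(1) b(1) by (simp only: mult.commute)
    ultimately show "\<exists>a b. F = a * f + b * g \<and> homogeneous a (n + d2) \<and> homogeneous b (n + d1)"
      by blast
  qed
qed

subsection \<open>The greatest common divisor of the lowest components\<close>

lemma power_monomial:
  "single (expo4 a b c e) 1 ^ n = (single (expo4 (n * a) (n * b) (n * c) (n * e)) 1 :: 'k::field mpoly4)"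
proof (induction n)
  case 0
  have "expo4 0 0 0 0 = 0" by (rule expo_eqI) auto
  then show ?case by simp
next
  case (Suc n)
  have "expo4 a b c e + expo4 (n * a) (n * b) (n * c) (n * e) =
    expo4 (Suc n * a) (Suc n * b) (Suc n * c) (Suc n * e)"
    by (rule expo_eqI) (auto simp: lookup_add)
  then show ?case by (simp add: Suc mult_single)
qed

lemma hom_wt_power_expo4:
  fixes F :: "'k::field mpoly4"
  assumes "hom_wt bideg (bideg (expo4 a b c e)) F"
  shows "hom_wt bideg (bideg (expo4 (n * a) (n * b) (n * c) (n * e))) (F ^ n)"
proof (induction n)
  case 0
  show ?case by (simp add: hom_wt_def bideg_def)
next
  case (Suc n)
  have "bideg (expo4 a b c e) + bideg (expo4 (n * a) (n * b) (n * c) (n * e)) =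
    bideg (expo4 (Suc n * a) (Suc n * b) (Suc n * c) (Suc n * e))"
    by (simp add: bideg_def algebra_simps)
  then show ?case using hom_wt_mult[OF additive_bideg assms Suc] by simp
qed

text \<open>Modulo the prime ideal of the curve, a bihomogeneous \<open>t\<close> outside of it is a scalar multiple of
  any of its monomials.\<close>

lemma monomial_power_mod_ideal:
  fixes f g t :: "'k::field mpoly4"
  assumes rad: "radical (ideal2 f g) = macaulay_ideal"
    and t: "hom_wt bideg v t" "t \<notin> macaulay_ideal" "m0 \<in> keys t"
    and m1: "bideg (m0 + m1) = bideg (expo4 a b c e)"
  obtains n C where "single (expo4 (n * a) (n * b) (n * c) (n * e)) 1 - t * C \<in> ideal2 f g"
    "\<And>m. m \<in> keys C \<Longrightarrow> bideg m + v = bideg (expo4 (n * a) (n * b) (n * c) (n * e))"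
proof -
  define \<gamma> where "\<gamma> = eval4 t 1 1 1 1"
  have \<gamma>: "\<gamma> \<noteq> 0" using t(2) bihom_in_macaulay_ideal_iff[OF t(1)] by (simp add: \<gamma>_def)
  define Q where "Q = (single (expo4 a b c e) 1 :: 'k mpoly4)"
  \<comment> \<open>The factor \<open>inverse \<gamma>\<close> makes \<open>u\<close> vanish at
    \<open>(1, 1, 1, 1)\<close>; being bihomogeneous, \<open>u\<close> lies in the ideal of the
    curve.\<close>
  define u where "u = Q - t * single m1 (inverse \<gamma>)"
  have v: "bideg m0 = v" using t(1,3) by (simp add: hom_wt_def)
  have Q: "hom_wt bideg (bideg (expo4 a b c e)) Q" by (simp add: Q_def hom_wt_single)
  have "hom_wt bideg (v + bideg m1) (t * single m1 (inverse \<gamma>))"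
    by (intro hom_wt_mult additive_bideg t hom_wt_single refl)
  moreover have "v + bideg m1 = bideg (expo4 a b c e)"
    using m1 v additive_bideg by (simp add: additive_def)
  ultimately have u: "hom_wt bideg (bideg (expo4 a b c e)) u"
    using Q unfolding u_def by (intro hom_wt_diff) auto
  have "eval4 u 1 1 1 1 = 0"
    using \<gamma> by (simp add: u_def Q_def eval4.ev_diff eval4.ev_mult mon_eval_def flip: \<gamma>_def)
  then have "u \<in> radical (ideal2 f g)" unfolding rad using bihom_in_macaulay_ideal_iff[OF u] by simp
  then obtain n where n: "u ^ n \<in> ideal2 f g" by (auto simp: radical_def)
  \<comment> \<open>\<open>Q - u\<close> is a multiple of \<open>t\<close> and divides
    \<open>Q ^ n - u ^ n\<close>.\<close>
  have "Q ^ n - u ^ n = t * (single m1 (inverse \<gamma>) * (\<Sum>i<n. u ^ (n - Suc i) * Q ^ i))"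
    by (simp add: power_diff_sumr2 u_def mult.assoc)
  then obtain C where C: "Q ^ n - u ^ n = t * C" by blast
  let ?T = "expo4 (n * a) (n * b) (n * c) (n * e)"
  show ?thesis
  proof (rule that)
    have "single ?T 1 - t * C = u ^ n"
      unfolding C[symmetric] Q_def power_monomial by simp
    then show "single ?T 1 - t * C \<in> ideal2 f g" using n by simp
    fix m assume m: "m \<in> keys C"
    then have C0: "C \<noteq> 0" by auto
    have t0: "t \<noteq> 0" using t(3) by auto
    have "hom_wt bideg (bideg ?T) (t * C)"
      unfolding C[symmetric] by (intro hom_wt_diff hom_wt_power_expo4 Q u)
    then obtain i j where ij: "hom_wt bideg i t" "hom_wt bideg j C" "i + j = bideg ?T"
      by (rule hom_wt_bideg_factor[OF _ t0 C0])
    have "i = v" "j = bideg m" using ij m t(3) v by (auto simp: hom_wt_def)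
    then show "bideg m + v = bideg ?T" using ij(3) by (simp add: add.commute)
  qed
qed

text \<open>The degree and three small exponents determine a monomial, so the number of monomials
  divisible by none of \<open>x ^ p\<close>, \<open>y ^ q\<close> and \<open>(w z) ^ r\<close> is
  bounded independently of \<open>n\<close>.\<close>

lemma monomials_outside_corner:
  obtains A where "finite A" "card A \<le> 2 * (p * q * r)"
    "\<And>m. tdeg m = n \<Longrightarrow> lookup m X < p \<Longrightarrow> lookup m Y < q \<Longrightarrow> lookup m W < r \<or> lookup m Z < r \<Longrightarrow> m \<in> A"
proof -
  let ?D = "{..<p} \<times> {..<q} \<times> {..<r}"
  let ?h = "\<lambda>(b, c, a). expo4 a b c (n - a - b - c)" and ?h' = "\<lambda>(b, c, e). expo4 (n - b - c - e) b c e"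
  show ?thesis
  proof (rule that[of "?h ` ?D \<union> ?h' ` ?D"])
    have "card (?h ` ?D \<union> ?h' ` ?D) \<le> card (?h ` ?D) + card (?h' ` ?D)" by (rule card_Un_le)
    also have "\<dots> \<le> card ?D + card ?D" by (intro add_mono card_image_le) auto
    finally show "card (?h ` ?D \<union> ?h' ` ?D) \<le> 2 * (p * q * r)" by (simp add: card_cartesian_product)
    fix m assume m: "tdeg m = n" "lookup m X < p" "lookup m Y < q" "lookup m W < r \<or> lookup m Z < r"
    show "m \<in> ?h ` ?D \<union> ?h' ` ?D"
    proof (cases "lookup m W < r")
      case True
      have "m = ?h (lookup m X, lookup m Y, lookup m W)"
        using m(1) by (auto simp: tdeg_def intro!: expo_eqI)
      then have "m \<in> ?h ` ?D" using True m(2,3) by (intro image_eqI) auto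
      then show ?thesis by blast
    next
      case False
      have "m = ?h' (lookup m X, lookup m Y, lookup m Z)"
        using m(1) by (auto simp: tdeg_def intro!: expo_eqI)
      then have "m \<in> ?h' ` ?D" using False m(2-4) by (intro image_eqI) auto
      then show ?thesis by blast
    qed
  qed auto
qed

lemma tdeg_eq_if_bideg_eq: "bideg m = bideg n \<Longrightarrow> tdeg m = tdeg n"
  using bideg_sum[of m] bideg_sum[of n] by simp

text \<open>Up to the factor 6, this is the Hilbert function in degree \<open>n + a + b\<close> of
  the quotient by coprime forms of degrees \<open>a\<close> and \<open>b\<close>; its slope is
  \<open>a * b\<close>.\<close>

lemma hdim_second_difference:
  "6 * (int (hdim (n + a + b)) - int (hdim (n + a)) - int (hdim (n + b)) + int (hdim n)) =
    int a * int b * (6 * int n + 12 + 3 * (int a + int b))"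
proof -
  have "6 * (int (hdim (n + a + b)) - int (hdim (n + a)) - int (hdim (n + b)) + int (hdim n)) =
    6 * int (hdim (n + a + b)) - 6 * int (hdim (n + a)) - 6 * int (hdim (n + b)) + 6 * int (hdim n)"
    by simp
  then show ?thesis unfolding hdim_eq by (simp add: algebra_simps)
qed

text \<open>Comparing the dimension in degree \<open>n\<close> with the number of generators leaves
  a second difference of \<open>hdim\<close>. Its slope \<open>e * (d1 + d2 - e)\<close> must
  vanish, since only boundedly many exceptional monomials can compensate for it.\<close>

lemma degree_gcd_low_parts:
  fixes f g t f' g' :: "'k::field mpoly4" and \<omega> :: "expo \<Rightarrow> nat"
  assumes add: "additive \<omega>" and \<omega>: "\<And>m n. bideg m = bideg n \<Longrightarrow> \<omega> m = \<omega> n"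
    and \<omega>_le: "\<And>m. \<omega> m \<le> 4 * tdeg m"
    and f: "homogeneous f d1" "f \<noteq> 0" and g: "homogeneous g d2" "g \<noteq> 0"
    and rad: "radical (ideal2 f g) = macaulay_ideal"
    and f0: "low_part \<omega> f = t * f'" and g0: "low_part \<omega> g = t * g'"
    and t: "hom_wt bideg v t" "t \<notin> macaulay_ideal" "hom_wt tdeg e t"
    and coprime: "\<And>r. r dvd f' \<Longrightarrow> r dvd g' \<Longrightarrow> r dvd 1"
  shows "e = 0"
proof (rule ccontr)
  assume "e \<noteq> 0"
  have nz: "t \<noteq> 0" "f' \<noteq> 0" "g' \<noteq> 0"
    using low_part_nonzero[OF f(2), of \<omega>] low_part_nonzero[OF g(2), of \<omega>] unfolding f0 g0 by auto
  obtain m0 where m0: "m0 \<in> keys t" using nz(1) by (metis keys_eq_empty ex_in_conv)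
  have m0': "bideg m0 = v" "tdeg m0 = e" using t m0 by (auto simp: hom_wt_def)
  \<comment> \<open>\<open>t\<close> is homogeneous for the degree and for \<open>\<omega>\<close>,
    hence so are the cofactors; the monomial \<open>m0\<close> records both shifts.\<close>
  have cofactor: "\<exists>d' p'. homogeneous F' d' \<and> d = e + d' \<and> hom_wt \<omega> p' F' \<and> Min (\<omega> ` keys F) = \<omega> m0 + p'"
    if F: "homogeneous F d" "low_part \<omega> F = t * F'" "F' \<noteq> 0" for F F' :: "'k mpoly4" and d
  proof -
    have 1: "hom_wt tdeg d (t * F')" unfolding F(2)[symmetric] low_part_def
      using F(1) by (simp add: homogeneous_iff_hom_wt hom_wt_restr')
    obtain i j where ij: "hom_wt tdeg i t" "hom_wt tdeg j F'" "i + j = d"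
      by (rule hom_wt_factor[OF additive_tdeg 1 nz(1) F(3)])
    have 2: "hom_wt \<omega> (Min (\<omega> ` keys F)) (t * F')" unfolding F(2)[symmetric] low_part_def
      by (rule hom_wt_restr)
    obtain i' j' where ij': "hom_wt \<omega> i' t" "hom_wt \<omega> j' F'" "i' + j' = Min (\<omega> ` keys F)"
      by (rule hom_wt_factor[OF add 2 nz(1) F(3)])
    have "i = e" "i' = \<omega> m0" using ij ij' m0 m0' by (auto simp: hom_wt_def)
    then have "hom_wt tdeg j F'" "d = e + j" "hom_wt \<omega> j' F'" "Min (\<omega> ` keys F) = \<omega> m0 + j'"
      using ij ij' by simp_all
    then show ?thesis unfolding homogeneous_iff_hom_wt by blast
  qed
  obtain d1' p' where f': "homogeneous f' d1'" "d1 = e + d1'" "hom_wt \<omega> p' f'" "Min (\<omega> ` keys f) = \<omega> m0 + p'"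
    using cofactor[OF f(1) f0 nz(2)] by blast
  obtain d2' q' where g': "homogeneous g' d2'" "d2 = e + d2'" "hom_wt \<omega> q' g'" "Min (\<omega> ` keys g) = \<omega> m0 + q'"
    using cofactor[OF g(1) g0 nz(3)] by blast

  let ?a = "lookup m0 W" and ?b = "lookup m0 X" and ?c = "lookup m0 Y" and ?e = "lookup m0 Z"
  \<comment> \<open>A monomial completing \<open>m0\<close> to the bidegree of a power of
    \<open>x\<close>; \<open>y\<close> and \<open>w z\<close> are treated alike below.\<close>
  have "bideg (m0 + expo4 (2 * ?a + 2 * ?c + 3 * ?e) (3 * ?b + ?c) 0 ?a) = bideg (expo4 0 (4 * tdeg m0) 0 0)"
    by (simp add: bideg_def tdeg_def lookup_add)
  from monomial_power_mod_ideal[OF rad t(1,2) m0 this]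
  obtain n1 C1 where C1: "single (expo4 0 (n1 * (4 * tdeg m0)) 0 0) 1 - t * C1 \<in> ideal2 f g"
    "\<And>m. m \<in> keys C1 \<Longrightarrow> bideg m + v = bideg (expo4 0 (n1 * (4 * tdeg m0)) 0 0)"
    by (metis mult_0_right)
  have "bideg (m0 + expo4 ?e 0 (?b + 3 * ?c) (3 * ?a + 2 * ?b + 2 * ?e)) = bideg (expo4 0 0 (4 * tdeg m0) 0)"
    by (simp add: bideg_def tdeg_def lookup_add)
  from monomial_power_mod_ideal[OF rad t(1,2) m0 this]
  obtain n2 C2 where C2: "single (expo4 0 0 (n2 * (4 * tdeg m0)) 0) 1 - t * C2 \<in> ideal2 f g"
    "\<And>m. m \<in> keys C2 \<Longrightarrow> bideg m + v = bideg (expo4 0 0 (n2 * (4 * tdeg m0)) 0)"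
    by (metis mult_0_right)
  have "bideg (m0 + expo4 ?e ?c ?b ?a) = bideg (expo4 (tdeg m0) 0 0 (tdeg m0))"
    by (simp add: bideg_def tdeg_def lookup_add)
  from monomial_power_mod_ideal[OF rad t(1,2) m0 this]
  obtain n3 C3 where C3: "single (expo4 (n3 * tdeg m0) 0 0 (n3 * tdeg m0)) 1 - t * C3 \<in> ideal2 f g"
    "\<And>m. m \<in> keys C3 \<Longrightarrow> bideg m + v = bideg (expo4 (n3 * tdeg m0) 0 0 (n3 * tdeg m0))"
    by (metis mult_0_right)
  \<comment> \<open>Modulo \<open>(f, g)\<close>, now \<open>x ^ k1\<close>, \<open>y ^ k2\<close>
    and \<open>(w z) ^ k3\<close> are multiples of \<open>t\<close>.\<close>
  define k1 k2 k3 where "k1 = n1 * (4 * tdeg m0)" and "k2 = n2 * (4 * tdeg m0)" and "k3 = n3 * tdeg m0"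
  note C = C1[folded k1_def] C2[folded k2_def] C3[folded k3_def]

  \<comment> \<open>\<open>N\<close> lies above the bound for the number of exceptional monomials,
    which the final estimate contradicts.\<close>
  define N where "N = 2 * (k1 * k2 * k3) + 1"
  define n where "n = N + d1 + d2"
  obtain G where G: "finite G" "card G + hdim N \<le> hdim (N + d2) + hdim (N + d1)"
    "\<And>a b. homogeneous a (N + d2) \<Longrightarrow> homogeneous b (N + d1) \<Longrightarrow> a * f + b * g \<in> mp.span G"
    by (rule ideal2_dim_upper[OF f(1) g, where n = N]) (rule that)
  have G': "F \<in> mp.span G" if F: "F \<in> ideal2 f g" "homogeneous F n" for F
  proof -
    obtain a b where ab: "F = a * f + b * g" by (rule ideal2E[OF F(1)])
    have "F = restr (\<lambda>m. tdeg m = n) F"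
      using F(2) by (intro restr_id[symmetric]) (simp add: homogeneous_def)
    also have "\<dots> = restr (\<lambda>m. tdeg m = (N + d2) + d1) (a * f) + restr (\<lambda>m. tdeg m = (N + d1) + d2) (b * g)"
      unfolding ab restr_add n_def by (simp add: add_ac)
    also have "restr (\<lambda>m. tdeg m = (N + d2) + d1) (a * f) = restr (\<lambda>m. tdeg m = N + d2) a * f"
      using f(1) by (intro restr_mult_hom additive_tdeg) (simp add: homogeneous_iff_hom_wt)
    also have "restr (\<lambda>m. tdeg m = (N + d1) + d2) (b * g) = restr (\<lambda>m. tdeg m = N + d1) b * g"
      using g(1) by (intro restr_mult_hom additive_tdeg) (simp add: homogeneous_iff_hom_wt)
    finally have F_eq: "F = restr (\<lambda>m. tdeg m = N + d2) a * f + restr (\<lambda>m. tdeg m = N + d1) b * g" .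
    show ?thesis by (subst F_eq) (intro G(3), auto simp: homogeneous_def)
  qed
  \<comment> \<open>The shift \<open>N + e\<close> gives the cofactors of \<open>f'\<close> and
    \<open>g'\<close> the same degrees as those of \<open>f\<close> and \<open>g\<close> in degree
    \<open>n\<close>.\<close>
  obtain K where K: "mp.independent K"
    "card K + hdim (N + e) = hdim (N + e + d2') + hdim (N + e + d1')"
    "\<And>F. F \<in> mp.span K \<Longrightarrow>
      \<exists>a b. F = a * f' + b * g' \<and> homogeneous a (N + e + d2') \<and> homogeneous b (N + e + d1')"
    by (rule ideal2_dim_lower[OF f'(1) nz(2) g'(1) nz(3), where n = "N + e"]) ((rule coprime; assumption), rule that)
  have Nd: "N + e + d2' = N + d2" "N + e + d1' = N + d1" by (simp_all add: f' g')
  define m where "m = N + e + d1' + d2'"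
  have n_eq: "n = m + e" by (simp add: n_def m_def f' g')
  have "K \<subseteq> mp.span (Mon m)"
  proof
    fix F assume "F \<in> K"
    then obtain a b where ab: "F = a * f' + b * g'" "homogeneous a (N + e + d2')" "homogeneous b (N + e + d1')"
      using K(3)[OF mp.span_base] by blast
    have "homogeneous (a * f') (N + e + d2' + d1')" "homogeneous (b * g') (N + e + d1' + d2')"
      by (intro homogeneous_mult ab f' g')+
    then have "homogeneous F m"
      unfolding ab(1) homogeneous_iff_hom_wt m_def by (intro hom_wt_add) (simp_all add: add_ac)
    then show "F \<in> mp.span (Mon m)" by (simp add: span_Mon)
  qed
  then obtain S where S: "S \<subseteq> Mon m" "Mon m \<subseteq> mp.span (K \<union> S)" "card S + card K = hdim m" "finite S"
    by (rule ex_monomial_complement[OF K(1)])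
  \<comment> \<open>Modulo \<open>(f', g')\<close> a monomial is a combination of \<open>S\<close>.
    Restricting to its weight keeps \<open>s\<close> in the span of the monomials \<open>S\<close>
    and fixes the weights of the cofactors.\<close>
  have decomp: "\<exists>s a b. single \<mu> 1 = s + a * f' + b * g' \<and> s \<in> mp.span S \<and>
      homogeneous a (N + d2) \<and> homogeneous b (N + d1) \<and>
      (\<forall>k\<in>keys a. \<omega> k + p' = \<omega> \<mu>) \<and> (\<forall>k\<in>keys b. \<omega> k + q' = \<omega> \<mu>)"
    if \<mu>: "tdeg \<mu> = m" for \<mu>
  proof -
    have "single \<mu> 1 \<in> mp.span (K \<union> S)" using S(2) \<mu> by (auto simp: Mon_def monomials_def)
    then obtain x s where xs: "single \<mu> 1 = x + s" "x \<in> mp.span K" "s \<in> mp.span S"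
      unfolding mp.span_Un by blast
    obtain a b where ab: "x = a * f' + b * g'" "homogeneous a (N + d2)" "homogeneous b (N + d1)"
      using K(3)[OF xs(2)] unfolding Nd by blast
    let ?P = "\<lambda>k. \<omega> k = \<omega> \<mu>"
    have af: "restr ?P (a * f') = restr (\<lambda>k. \<omega> k + p' = \<omega> \<mu>) a * restr (\<lambda>_. True) f'"
      by (rule restr_mult) (use add f'(3) in \<open>auto simp: additive_def hom_wt_def\<close>)
    have bg: "restr ?P (b * g') = restr (\<lambda>k. \<omega> k + q' = \<omega> \<mu>) b * restr (\<lambda>_. True) g'"
      by (rule restr_mult) (use add g'(3) in \<open>auto simp: additive_def hom_wt_def\<close>)
    have "single \<mu> 1 = restr ?P (single \<mu> 1 :: 'k mpoly4)" by (rule restr_id[symmetric]) simp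
    also have "\<dots> = restr ?P (a * f') + restr ?P (b * g') + restr ?P s"
      by (simp only: xs(1) ab(1) restr_add)
    finally have "single \<mu> 1 = restr ?P s + restr (\<lambda>k. \<omega> k + p' = \<omega> \<mu>) a * f' + restr (\<lambda>k. \<omega> k + q' = \<omega> \<mu>) b * g'"
      unfolding af bg by (simp add: restr_id add_ac)
    moreover have "restr ?P s \<in> mp.span S"
      using S(1) xs(3) unfolding Mon_def by (rule restr_in_span)
    ultimately show ?thesis
      using ab(2,3)
      by (intro exI[of _ "restr ?P s"] exI[of _ "restr (\<lambda>k. \<omega> k + p' = \<omega> \<mu>) a"]
          exI[of _ "restr (\<lambda>k. \<omega> k + q' = \<omega> \<mu>) b"]) (auto simp: homogeneous_def)
  qed
  obtain A where A: "finite A" "card A \<le> 2 * (k1 * k2 * k3)"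
    "\<And>\<mu>. tdeg \<mu> = n \<Longrightarrow> lookup \<mu> X < k1 \<Longrightarrow> lookup \<mu> Y < k2 \<Longrightarrow> lookup \<mu> W < k3 \<or> lookup \<mu> Z < k3 \<Longrightarrow> \<mu> \<in> A"
    using monomials_outside_corner[of k1 k2 k3 n] by blast

  define gens where "gens = G \<union> (\<lambda>F. t * F) ` S \<union> monomials A"
  have G_gens: "F \<in> mp.span gens" if "F \<in> mp.span G" for F
    using that mp.span_mono[of G gens] by (auto simp: gens_def)
  have S_gens: "t * F \<in> mp.span gens" if "F \<in> mp.span S" for F
    using mult_span_image[OF that, of t] mp.span_mono[of "(\<lambda>F. t * F) ` S" gens] by (auto simp: gens_def)
  \<comment> \<open>Descending induction on the weight, which is at most \<open>4 * n\<close> in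
    degree \<open>n\<close>.\<close>
  have span: "single \<mu> 1 \<in> mp.span gens" if "tdeg \<mu> = n" for \<mu>
    using that
  proof (induction "4 * n - \<omega> \<mu>" arbitrary: \<mu> rule: less_induct)
    case less
    have high: "F \<in> mp.span gens" if F: "\<And>k. k \<in> keys F \<Longrightarrow> tdeg k = n \<and> \<omega> \<mu> < \<omega> k" for F
    proof -
      have "single k 1 \<in> mp.span gens" if "k \<in> keys F" for k
      proof (rule less.hyps)
        have "\<omega> \<mu> < \<omega> k" "\<omega> k \<le> 4 * n" using F[OF that] \<omega>_le[of k] by auto
        then show "4 * n - \<omega> k < 4 * n - \<omega> \<mu>" by linarith
      qed (use F[OF that] in simp)
      then have "monomials (keys F) \<subseteq> mp.span gens" by (auto simp: monomials_def)
      then have "mp.span (monomials (keys F)) \<subseteq> mp.span gens" by (metis mp.span_mono mp.span_span)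
      then show ?thesis by (auto simp: span_monomials)
    qed
    \<comment> \<open>A multiple \<open>\<mu>\<close> of one of the three special monomials
      \<open>T\<close> is congruent to \<open>t * D\<close> modulo \<open>(f, g)\<close>, with
      \<open>D\<close> of degree \<open>m\<close>.\<close>
    have reduce: ?case
      if T: "single T 1 - t * C \<in> ideal2 f g" "\<And>m. m \<in> keys C \<Longrightarrow> bideg m + v = bideg T" "\<mu> = \<nu> + T" for T C \<nu>
    proof -
      define D where "D = single \<nu> 1 * C"
      have kD: "bideg (k + m0) = bideg \<mu>" if kk: "k \<in> keys D" for k
      proof -
        obtain m where "m \<in> keys C" "k = \<nu> + m" using kk by (auto simp: D_def elim!: keys_multE)
        then show ?thesis using T(2)[of m] additive_bideg by (simp add: additive_def m0' T(3) add.assoc)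
      qed
      have kD': "tdeg k = m" "\<omega> k + \<omega> m0 = \<omega> \<mu>" if kk: "k \<in> keys D" for k
      proof -
        have "tdeg (k + m0) = tdeg \<mu>" "\<omega> (k + m0) = \<omega> \<mu>"
          using tdeg_eq_if_bideg_eq[OF kD[OF kk]] \<omega>[OF kD[OF kk]] by auto
        then show "tdeg k = m" "\<omega> k + \<omega> m0 = \<omega> \<mu>"
          using add additive_tdeg less.prems by (auto simp: additive_def m0' n_eq)
      qed
      have tk: "t * single k 1 \<in> mp.span gens" if kk: "k \<in> keys D" for k
      proof -
        obtain s a b where sab: "single k 1 = s + a * f' + b * g'" "s \<in> mp.span S"
          "homogeneous a (N + d2)" "homogeneous b (N + d1)"
          "\<forall>i\<in>keys a. \<omega> i + p' = \<omega> k" "\<forall>i\<in>keys b. \<omega> i + q' = \<omega> k"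
          using decomp[OF kD'(1)[OF kk]] by blast
        \<comment> \<open>Here \<open>t * f'\<close> and \<open>t * g'\<close> become
          \<open>f\<close> and \<open>g\<close> minus terms of higher weight, which the induction
          covers.\<close>
        have "t * single k 1 = t * s + (a * f + b * g) - (a * (f - t * f') + b * (g - t * g'))"
          unfolding sab(1) by (simp add: algebra_simps)
        moreover have "a * (f - t * f') \<in> mp.span gens"
        proof (rule high)
          fix i assume "i \<in> keys (a * (f - t * f'))"
          then obtain i1 i2 where i: "i1 \<in> keys a" "i2 \<in> keys (f - low_part \<omega> f)" "i = i1 + i2"
            unfolding f0[symmetric] by (rule keys_multE)
          have "i2 \<in> keys f"
            using i(2) by (auto simp: in_keys_iff lookup_minus low_part_def lookup_restr split: if_splits)
          then have "tdeg i = n"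
            using i sab(3) f(1) additive_tdeg by (auto simp: homogeneous_def additive_def n_def)
          moreover have "\<omega> i1 + p' = \<omega> k" "\<omega> m0 + p' < \<omega> i2"
            using sab(5) i keys_diff_low_part[OF i(2)] f'(4) by auto
          then have "\<omega> \<mu> < \<omega> i" using kD'(2)[OF kk] add by (simp add: i(3) additive_def)
          ultimately show "tdeg i = n \<and> \<omega> \<mu> < \<omega> i" ..
        qed
        moreover have "b * (g - t * g') \<in> mp.span gens"
        proof (rule high)
          fix i assume "i \<in> keys (b * (g - t * g'))"
          then obtain i1 i2 where i: "i1 \<in> keys b" "i2 \<in> keys (g - low_part \<omega> g)" "i = i1 + i2"
            unfolding g0[symmetric] by (rule keys_multE)
          have "i2 \<in> keys g"
            using i(2) by (auto simp: in_keys_iff lookup_minus low_part_def lookup_restr split: if_splits)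
          then have "tdeg i = n"
            using i sab(4) g(1) additive_tdeg by (auto simp: homogeneous_def additive_def n_def)
          moreover have "\<omega> i1 + q' = \<omega> k" "\<omega> m0 + q' < \<omega> i2"
            using sab(6) i keys_diff_low_part[OF i(2)] g'(4) by auto
          then have "\<omega> \<mu> < \<omega> i" using kD'(2)[OF kk] add by (simp add: i(3) additive_def)
          ultimately show "tdeg i = n \<and> \<omega> \<mu> < \<omega> i" ..
        qed
        moreover have "t * s \<in> mp.span gens" by (rule S_gens[OF sab(2)])
        moreover have "a * f + b * g \<in> mp.span gens" by (rule G_gens[OF G(3)[OF sab(3,4)]])
        ultimately show ?thesis by (simp only: mp.span_add mp.span_diff)
      qed
      have tD: "t * D \<in> mp.span gens"
      proof -
        have "t * D = (\<Sum>k\<in>keys D. mscale (lookup D k) (t * single k 1))"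
          by (subst poly_mapping_eq_sum_single[of D])
            (simp add: sum_distrib_left mult.left_commute[of _ t] mult_single)
        also have "\<dots> \<in> mp.span gens" by (intro mp.span_sum mp.span_scale tk)
        finally show ?thesis .
      qed
      have eq: "single \<nu> 1 * (single T 1 - t * C) = single \<mu> 1 - t * D"
        by (simp add: T(3) D_def right_diff_distrib mult_single mult.left_commute)
      have "single \<mu> 1 - t * D \<in> mp.span G"
      proof (rule G')
        obtain a b where "single T 1 - t * C = a * f + b * g" by (rule ideal2E[OF T(1)])
        then have "single \<mu> 1 - t * D = (single \<nu> 1 * a) * f + (single \<nu> 1 * b) * g"
          unfolding eq[symmetric] by (simp only: distrib_left mult.assoc)
        then show "single \<mu> 1 - t * D \<in> ideal2 f g" by (rule ideal2I)
        have "hom_wt tdeg m D" using kD'(1) by (simp add: hom_wt_def)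
        then have "hom_wt tdeg (e + m) (t * D)" by (rule hom_wt_mult[OF additive_tdeg t(3)])
        then show "homogeneous (single \<mu> 1 - t * D) n"
          unfolding homogeneous_iff_hom_wt
          using less.prems by (intro hom_wt_diff hom_wt_single) (simp_all add: n_eq add.commute)
      qed
      from mp.span_add[OF G_gens[OF this] tD] show ?thesis by simp
    qed
    consider "\<mu> \<in> A" | "k1 \<le> lookup \<mu> X" | "k2 \<le> lookup \<mu> Y" | "k3 \<le> lookup \<mu> W" "k3 \<le> lookup \<mu> Z"
      using A(3)[OF less.prems] by fastforce
    then show ?case
    proof cases
      case 1
      then show ?thesis by (intro mp.span_base) (auto simp: gens_def monomials_def)
    next
      case 2
      show ?thesis
        by (rule reduce[OF C(1,2), where \<nu> = "expo4 (lookup \<mu> W) (lookup \<mu> X - k1) (lookup \<mu> Y) (lookup \<mu> Z)"])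
          (use 2 in \<open>auto intro!: expo_eqI simp: lookup_add\<close>)
    next
      case 3
      show ?thesis
        by (rule reduce[OF C(3,4), where \<nu> = "expo4 (lookup \<mu> W) (lookup \<mu> X) (lookup \<mu> Y - k2) (lookup \<mu> Z)"])
          (use 3 in \<open>auto intro!: expo_eqI simp: lookup_add\<close>)
    next
      case 4
      show ?thesis
        by (rule reduce[OF C(5,6), where \<nu> = "expo4 (lookup \<mu> W - k3) (lookup \<mu> X) (lookup \<mu> Y) (lookup \<mu> Z - k3)"])
          (use 4 in \<open>auto intro!: expo_eqI simp: lookup_add\<close>)
    qed
  qed
  have rearrange: "6 * (i - j - k + l) \<le> 6 * x" if "i + l \<le> j + k + x" for i j k l x :: int
    using that by simp
  have "(Mon n :: 'k mpoly4 set) \<subseteq> mp.span gens"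
    using span by (auto simp: Mon_def monomials_def)
  moreover have "finite gens" using G(1) S(4) A(1) by (auto simp: gens_def monomials_def)
  ultimately have "hdim n \<le> card gens"
    using mp.independent_span_bound[of gens "Mon n"] independent_monomials card_Mon(2)[of n, where 'k = 'k]
    by (auto simp: Mon_def)
  also have "card gens \<le> card G + card S + card A"
  proof -
    have "card gens \<le> card (G \<union> (\<lambda>F. t * F) ` S) + card (monomials A :: 'k mpoly4 set)"
      unfolding gens_def by (rule card_Un_le)
    also have "\<dots> \<le> card G + card ((\<lambda>F. t * F) ` S) + card (monomials A :: 'k mpoly4 set)"
      by (intro add_right_mono card_Un_le)
    also have "\<dots> \<le> card G + card S + card A"
      unfolding monomials_def by (intro add_mono card_image_le S A order.refl)
    finally show ?thesis .
  qed
  \<comment> \<open>The terms \<open>hdim (N + d1)\<close> and \<open>hdim (N + d2)\<close> from the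
    cardinalities of \<open>G\<close> and \<open>K\<close> cancel.\<close>
  finally have "hdim n + hdim N \<le> hdim m + hdim (N + e) + 2 * (k1 * k2 * k3)"
    using G(2) S(3) K(2) A(2) unfolding Nd by linarith
  moreover have "n = N + (e + d1' + d2') + e" "m = N + (e + d1' + d2')"
    by (simp_all add: n_def m_def f' g')
  ultimately have "int (hdim (N + (e + d1' + d2') + e) + hdim N) \<le>
      int (hdim (N + (e + d1' + d2')) + hdim (N + e) + 2 * (k1 * k2 * k3))"
    by (simp only: of_nat_le_iff)
  then have "6 * (int (hdim (N + (e + d1' + d2') + e)) - int (hdim (N + (e + d1' + d2'))) -
      int (hdim (N + e)) + int (hdim N)) \<le> 6 * int (2 * (k1 * k2 * k3))"
    unfolding of_nat_add by (rule rearrange)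
  then have "int (e + d1' + d2') * int e * (6 * int N + 12 + 3 * (int (e + d1' + d2') + int e)) \<le> 6 * int (2 * (k1 * k2 * k3))"
    unfolding hdim_second_difference .
  \<comment> \<open>For \<open>e > 0\<close> the slope is at least 1, so the second difference is
    too large.\<close>
  moreover have "1 * (6 * int N) \<le> int (e + d1' + d2') * int e * (6 * int N + 12 + 3 * (int (e + d1' + d2') + int e))"
  proof (rule mult_mono)
    have "0 < int (e + d1' + d2') * int e" using \<open>e \<noteq> 0\<close> by simp
    then show "1 \<le> int (e + d1' + d2') * int e" by linarith
  qed auto
  ultimately show False by (simp add: N_def)
qed

text \<open>A gcd outside the ideal would have degree zero by \<open>degree_gcd_low_parts\<close>
  and so be a unit. The lowest parts would then be coprime, which
  \<open>low_parts_not_coprime\<close> excludes.\<close>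

lemma gcd_low_parts_in_macaulay_ideal:
  fixes f g t :: "'k::field_char_0 mpoly4" and \<omega> :: "expo \<Rightarrow> nat"
  assumes closed: "alg_closed_field TYPE('k)"
    and add: "additive \<omega>" and \<omega>: "\<And>m n. bideg m = bideg n \<Longrightarrow> \<omega> m = \<omega> n"
    and \<omega>_le: "\<And>m. \<omega> m \<le> 4 * tdeg m"
    and f: "homogeneous f d1" "f \<noteq> 0" and g: "homogeneous g d2" "g \<noteq> 0"
    and rad: "radical (ideal2 f g) = macaulay_ideal"
    and f0: "hom_wt bideg v (low_part \<omega> f)" "low_part \<omega> f \<in> macaulay_ideal"
    and g0: "hom_wt bideg v' (low_part \<omega> g)" "low_part \<omega> g \<in> macaulay_ideal"
    and gcd: "is_gcd t (low_part \<omega> f) (low_part \<omega> g)"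
  shows "t \<in> macaulay_ideal"
proof (rule ccontr)
  assume t: "t \<notin> macaulay_ideal"
  obtain f' where f': "low_part \<omega> f = t * f'" using gcd by (auto simp: is_gcd_def elim: dvdE)
  obtain g' where g': "low_part \<omega> g = t * g'" using gcd by (auto simp: is_gcd_def elim: dvdE)
  have nz: "t \<noteq> 0" "f' \<noteq> 0"
    using low_part_nonzero[OF f(2), of \<omega>] unfolding f' by auto
  obtain i j where i: "hom_wt bideg i t" "hom_wt bideg j f'" "i + j = v"
    by (rule hom_wt_bideg_factor[OF f0(1)[unfolded f'] nz])
  \<comment> \<open>For a common divisor \<open>r\<close> of the cofactors, \<open>t * r\<close>
    divides the gcd \<open>t\<close>.\<close>
  have coprime: "r dvd 1" if "r dvd f'" "r dvd g'" for r
  proof -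
    have "t * r dvd t * f'" "t * r dvd t * g'" using that by (simp_all add: mult_dvd_mono)
    then have "t * r dvd t * 1" using gcd unfolding is_gcd_def f' g' by simp
    then show ?thesis using nz(1) unfolding dvd_mult_cancel_left by simp
  qed
  have "(fst i + snd i) div 4 = 0"
    by (rule degree_gcd_low_parts[OF add \<omega> \<omega>_le f g rad f' g' i(1) t hom_wt_bideg_tdeg[OF i(1)] coprime])
  then have t0: "hom_wt tdeg 0 t" using hom_wt_bideg_tdeg[OF i(1)] by simp
  have "m = 0" if "m \<in> keys t" for m
    using t0 that by (intro expo_eqI) (auto simp: hom_wt_def tdeg_def)
  then have "t = single 0 (lookup t 0)"
    by (intro poly_mapping_eqI) (metis in_keys_iff lookup_single_eq lookup_single_not_eq)
  moreover from this nz(1) have "lookup t 0 \<noteq> 0" by (metis single_zero)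
  ultimately have "t * single 0 (inverse (lookup t 0)) = 1"
    by (metis mult_single add_0 right_inverse single_one)
  then have unit: "t dvd 1" by (metis dvd_triv_left)
  show False
  proof (rule low_parts_not_coprime[OF closed add \<omega> f(2) g(2) rad f0 g0])
    fix r assume "r dvd low_part \<omega> f" "r dvd low_part \<omega> g"
    then have "r dvd t" using gcd by (simp add: is_gcd_def)
    then show "r dvd 1" using unit by (rule dvd_trans)
  qed
qed

theorem theorem1:
  fixes f g tmin tmax :: "'k::field_char_0 mpoly4" and d1 d2 :: nat
  assumes "alg_closed_field TYPE('k)"
    and "homogeneous f d1" and "homogeneous g d2"
    and "f \<in> macaulay_ideal" and "g \<in> macaulay_ideal"
    and "radical (ideal2 f g) = macaulay_ideal"
    and "f \<noteq> 0" and "g \<noteq> 0"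
    and "is_gcd tmin (comp_min f) (comp_min g)"
    and "is_gcd tmax (comp_max f) (comp_max g)"
  shows "tmin \<in> macaulay_ideal \<and> tmax \<in> macaulay_ideal"
proof
  have bicomp: "hom_wt bideg (i, 4 * d - i) (bicomp F i)" "bicomp F i \<in> macaulay_ideal"
    if "homogeneous F d" "F \<in> macaulay_ideal" for F :: "'k mpoly4" and d i
  proof -
    show hom: "hom_wt bideg (i, 4 * d - i) (bicomp F i)"
      using restr_homogeneous_bideg[OF that(1), of i] by (simp add: bicomp_def restr_def)
    show "bicomp F i \<in> macaulay_ideal"
      using bihom_in_macaulay_ideal_iff[OF hom] eval4_bicomp_macaulay_ideal[OF that(2)] by simp
  qed
  note mins = bicomp[OF assms(2,4), of "imin f"] bicomp[OF assms(3,5), of "imin g"]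
  note maxs = bicomp[OF assms(2,4), of "imax f"] bicomp[OF assms(3,5), of "imax g"]
  have le: "fst (bideg m) \<le> 4 * tdeg m" "snd (bideg m) \<le> 4 * tdeg m" for m
    using bideg_sum[of m] by linarith+
  \<comment> \<open>The two claims differ only in the weight: first degree for the minimal
    components, second degree for the maximal ones.\<close>
  show "tmin \<in> macaulay_ideal"
    by (rule gcd_low_parts_in_macaulay_ideal[OF assms(1) additive_fst_bideg _ le(1) assms(2,7,3,8,6)
          mins[folded comp_min_def, unfolded comp_min_eq_low_part] assms(9)[unfolded comp_min_eq_low_part]])
      simp
  show "tmax \<in> macaulay_ideal"
    by (rule gcd_low_parts_in_macaulay_ideal[OF assms(1) additive_snd_bideg _ le(2) assms(2,7,3,8,6)
          maxs[folded comp_max_def, unfolded comp_max_eq_low_part[OF assms(2,7)] comp_max_eq_low_part[OF assms(3,8)]]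
          assms(10)[unfolded comp_max_eq_low_part[OF assms(2,7)] comp_max_eq_low_part[OF assms(3,8)]]])
      simp
qed

end
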